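(* Let $R$ be a right Noetherian and right nonsingular ring. Then the following statements are equivalent. (1) $R$ is right almost-$QF$. (2) $R$ is right max-$QF$. (3) Every injective right $R$-module $E$ has a decomposition $E=E_1\oplus E_2$ where $\operatorname{Rad}(E_1)=E_1$ and $E_2$ is projective.
   Context: Rings are associative with identity and modules are unital. $\operatorname{Rad}(M)$ is the intersection of all maximal submodules of $M$ (equal to $M$ if there are none). A right $R$-module $M$ is $R$-projective (respectively, max-projective) if for every right ideal (respectively, maximal right ideal) $I$ of $R$ every homomorphism $M\to R/I$ factors through the canonical projection $R\to R/I$. $R$ is right almost-$QF$ (respectively, right max-$QF$) if every injective right $R$-module is $R$-projective (respectively, max-projective). $R$ is right nonsingular if no nonzero $r\in R$ satisfies $rI=0$ for some essential right ideal $I$ of $R$. *)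

theory Defs
  imports "HOL-Algebra.Module" "HOL-Algebra.QuotRing"
begin

(* Right modules over a not necessarily commutative ring are carried by the records of
   HOL-Algebra.Module.  The scalar is still written on the left, so "r \<odot>\<^bsub>M\<^esub> m" stands for
   m r; that the action is a right action is expressed by smult_assoc: m (a b) = (m a) b.
   The fields mult and one of a module record are never used. *)

locale right_module = R?: ring R + M?: abelian_group M
  for R (structure) and M :: "('a, 'b, 'c) module_scheme" (structure) +
  assumes smult_closed [simp, intro]:
      "\<lbrakk>a \<in> carrier R; x \<in> carrier M\<rbrakk> \<Longrightarrow> a \<odot>\<^bsub>M\<^esub> x \<in> carrier M"
    and smult_l_distr:
      "\<lbrakk>a \<in> carrier R; b \<in> carrier R; x \<in> carrier M\<rbrakk> \<Longrightarrow>
        (a \<oplus> b) \<odot>\<^bsub>M\<^esub> x = a \<odot>\<^bsub>M\<^esub> x \<oplus>\<^bsub>M\<^esub> b \<odot>\<^bsub>M\<^esub> x"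
    and smult_r_distr:
      "\<lbrakk>a \<in> carrier R; x \<in> carrier M; y \<in> carrier M\<rbrakk> \<Longrightarrow>
        a \<odot>\<^bsub>M\<^esub> (x \<oplus>\<^bsub>M\<^esub> y) = a \<odot>\<^bsub>M\<^esub> x \<oplus>\<^bsub>M\<^esub> a \<odot>\<^bsub>M\<^esub> y"
    and smult_assoc:
      "\<lbrakk>a \<in> carrier R; b \<in> carrier R; x \<in> carrier M\<rbrakk> \<Longrightarrow>
        (a \<otimes> b) \<odot>\<^bsub>M\<^esub> x = b \<odot>\<^bsub>M\<^esub> (a \<odot>\<^bsub>M\<^esub> x)"
    and smult_one [simp]:
      "x \<in> carrier M \<Longrightarrow> \<one> \<odot>\<^bsub>M\<^esub> x = x"

definition module_hom ::
    "('a, 'r) ring_scheme \<Rightarrow> ('a, 'b, 's) module_scheme \<Rightarrow> ('a, 'c, 't) module_scheme \<Rightarrow> ('b \<Rightarrow> 'c) set"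
  where "module_hom R M N =
    {f \<in> carrier M \<rightarrow> carrier N.
      (\<forall>x\<in>carrier M. \<forall>y\<in>carrier M. f (x \<oplus>\<^bsub>M\<^esub> y) = f x \<oplus>\<^bsub>N\<^esub> f y) \<and>
      (\<forall>r\<in>carrier R. \<forall>x\<in>carrier M. f (r \<odot>\<^bsub>M\<^esub> x) = r \<odot>\<^bsub>N\<^esub> f x)}"

(* The locale submodule of HOL-Algebra only asks for an additive subgroup that is closed under
   smult, so it applies to right modules as well. *)

abbreviation submodule_of :: "('a, 'b, 's) module_scheme \<Rightarrow> 'b set \<Rightarrow> ('a, 'b, 's) module_scheme"
  where "submodule_of M N \<equiv> M\<lparr>carrier := N\<rparr>"

definition maximal_submodule ::
    "('a, 'r) ring_scheme \<Rightarrow> ('a, 'b, 's) module_scheme \<Rightarrow> 'b set \<Rightarrow> bool"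
  where "maximal_submodule R M N \<longleftrightarrow>
    submodule N R M \<and> N \<noteq> carrier M \<and>
    (\<forall>K. submodule K R M \<and> N \<subseteq> K \<longrightarrow> K = N \<or> K = carrier M)"

definition module_Rad :: "('a, 'r) ring_scheme \<Rightarrow> ('a, 'b, 's) module_scheme \<Rightarrow> 'b set"
  where "module_Rad R M = carrier M \<inter> \<Inter>{N. maximal_submodule R M N}"

definition quotient_module :: "('a, 'b, 's) module_scheme \<Rightarrow> 'b set \<Rightarrow> ('a, 'b set) module"
  where "quotient_module M N =
    \<lparr>carrier = a_rcosets\<^bsub>M\<^esub> N, mult = undefined, one = undefined,
     zero = N, add = set_add M,
     smult = (\<lambda>r X. \<Union>x\<in>X. N +>\<^bsub>M\<^esub> (r \<odot>\<^bsub>M\<^esub> x))\<rparr>"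

definition regular_module :: "('a, 'r) ring_scheme \<Rightarrow> ('a, 'a) module"
  where "regular_module R =
    \<lparr>carrier = carrier R, mult = mult R, one = one R, zero = zero R, add = add R,
     smult = (\<lambda>r x. x \<otimes>\<^bsub>R\<^esub> r)\<rparr>"

definition right_ideal :: "('a, 'r) ring_scheme \<Rightarrow> 'a set \<Rightarrow> bool"
  where "right_ideal R I \<longleftrightarrow> submodule I R (regular_module R)"

definition maximal_right_ideal :: "('a, 'r) ring_scheme \<Rightarrow> 'a set \<Rightarrow> bool"
  where "maximal_right_ideal R I \<longleftrightarrow> maximal_submodule R (regular_module R) I"

definition right_noetherian :: "('a, 'r) ring_scheme \<Rightarrow> bool"
  where "right_noetherian R \<longleftrightarrow>
    (\<forall>I :: nat \<Rightarrow> 'a set. (\<forall>n. right_ideal R (I n)) \<and> (\<forall>n. I n \<subseteq> I (Suc n)) \<longrightarrow>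
      (\<exists>n. \<forall>m\<ge>n. I m = I n))"

definition essential_right_ideal :: "('a, 'r) ring_scheme \<Rightarrow> 'a set \<Rightarrow> bool"
  where "essential_right_ideal R I \<longleftrightarrow>
    right_ideal R I \<and> (\<forall>J. right_ideal R J \<and> J \<noteq> {\<zero>\<^bsub>R\<^esub>} \<longrightarrow> I \<inter> J \<noteq> {\<zero>\<^bsub>R\<^esub>})"

definition right_nonsingular :: "('a, 'r) ring_scheme \<Rightarrow> bool"
  where "right_nonsingular R \<longleftrightarrow>
    \<not> (\<exists>r\<in>carrier R. r \<noteq> \<zero>\<^bsub>R\<^esub> \<and>
        (\<exists>I. essential_right_ideal R I \<and> (\<forall>x\<in>I. r \<otimes>\<^bsub>R\<^esub> x = \<zero>\<^bsub>R\<^esub>)))"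

(* Injectivity and projectivity quantify over all modules, but a formula cannot quantify over
   types, so the carriers of the test modules are subsets of one fixed type.  For a module M over
   a ring R with carriers in 'm and 'a this type is ('m \<Rightarrow> 'a) set, which is large enough for the
   definitions to agree with testing against modules over every type:
   - it contains an isomorphic copy of R and all its right ideals (a is sent to {\<lambda>_. a}), so
     injectivity for these test modules gives Baer's criterion, hence injectivity for all;
   - it contains copies of the free module R^(M) (finitely supported functions f are sent to {f})
     and of every quotient of it, in particular of M, so projectivity for these test modules
     splits R^(M) \<rightarrow> M, hence gives projectivity for all. *)

definition injective_module :: "('a, 'r) ring_scheme \<Rightarrow> ('a, 'm) module \<Rightarrow> bool"
  where "injective_module R E \<longleftrightarrow>
    right_module R E \<and>
    (\<forall>(A :: ('a, ('m \<Rightarrow> 'a) set) module) (B :: ('a, ('m \<Rightarrow> 'a) set) module) i f.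
      right_module R A \<and> right_module R B \<and>
      i \<in> module_hom R A B \<and> inj_on i (carrier A) \<and> f \<in> module_hom R A E \<longrightarrow>
      (\<exists>h\<in>module_hom R B E. \<forall>x\<in>carrier A. h (i x) = f x))"

definition projective_module :: "('a, 'r) ring_scheme \<Rightarrow> ('a, 'm) module \<Rightarrow> bool"
  where "projective_module R P \<longleftrightarrow>
    right_module R P \<and>
    (\<forall>(B :: ('a, ('m \<Rightarrow> 'a) set) module) (C :: ('a, ('m \<Rightarrow> 'a) set) module) g f.
      right_module R B \<and> right_module R C \<and>
      g \<in> module_hom R B C \<and> g ` carrier B = carrier C \<and> f \<in> module_hom R P C \<longrightarrow>
      (\<exists>h\<in>module_hom R P B. \<forall>x\<in>carrier P. g (h x) = f x))"

definition lifts_modulo :: "('a, 'r) ring_scheme \<Rightarrow> ('a, 'm) module \<Rightarrow> 'a set \<Rightarrow> bool"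
  where "lifts_modulo R M I \<longleftrightarrow>
    (\<forall>f\<in>module_hom R M (quotient_module (regular_module R) I).
      \<exists>h\<in>module_hom R M (regular_module R). \<forall>x\<in>carrier M. f x = I +>\<^bsub>R\<^esub> h x)"

definition R_projective :: "('a, 'r) ring_scheme \<Rightarrow> ('a, 'm) module \<Rightarrow> bool"
  where "R_projective R M \<longleftrightarrow>
    right_module R M \<and> (\<forall>I. right_ideal R I \<longrightarrow> lifts_modulo R M I)"

definition max_projective :: "('a, 'r) ring_scheme \<Rightarrow> ('a, 'm) module \<Rightarrow> bool"
  where "max_projective R M \<longleftrightarrow>
    right_module R M \<and> (\<forall>I. maximal_right_ideal R I \<longrightarrow> lifts_modulo R M I)"

(* The next two notions refer to the modules with carrier in 'm.  In statements 'm is a free type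
   variable, so that modules over every type are covered; a statement holding for each 'm
   separately implies the one in which each notion quantifies over the modules of all types. *)

definition right_almost_QF :: "'m itself \<Rightarrow> ('a, 'r) ring_scheme \<Rightarrow> bool"
  where "right_almost_QF _ R \<longleftrightarrow>
    (\<forall>E :: ('a, 'm) module. injective_module R E \<longrightarrow> R_projective R E)"

definition right_max_QF :: "'m itself \<Rightarrow> ('a, 'r) ring_scheme \<Rightarrow> bool"
  where "right_max_QF _ R \<longleftrightarrow>
    (\<forall>E :: ('a, 'm) module. injective_module R E \<longrightarrow> max_projective R E)"

definition internal_direct_sum ::
    "('a, 'r) ring_scheme \<Rightarrow> ('a, 'm) module \<Rightarrow> 'm set \<Rightarrow> 'm set \<Rightarrow> bool"
  where "internal_direct_sum R M N K \<longleftrightarrow>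
    submodule N R M \<and> submodule K R M \<and> N \<inter> K = {\<zero>\<^bsub>M\<^esub>} \<and> N <+>\<^bsub>M\<^esub> K = carrier M"

lemma right_module_regular:
  assumes "ring R"
  shows "right_module R (regular_module R)"
proof -
  interpret ring R by fact
  have "abelian_group (regular_module R)"
  proof (rule abelian_groupI)
    fix x assume "x \<in> carrier (regular_module R)"
    then show "\<exists>y\<in>carrier (regular_module R).
        y \<oplus>\<^bsub>regular_module R\<^esub> x = \<zero>\<^bsub>regular_module R\<^esub>"
      by (intro bexI[of _ "\<ominus>\<^bsub>R\<^esub> x"]) (auto simp: regular_module_def l_neg)
  qed (auto simp: regular_module_def a_ac)
  then show ?thesis
    by (intro right_module.intro right_module_axioms.intro)
       (auto simp: assms regular_module_def l_distr r_distr m_assoc)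
qed

lemma (in right_module) right_module_submodule:
  assumes "submodule N R M"
  shows "right_module R (submodule_of M N)"
proof -
  interpret N: submodule N R M by fact
  have sub: "N \<subseteq> carrier M" using N.subset by simp
  have "abelian_group (submodule_of M N)"
  proof (rule abelian_groupI)
    fix x assume x: "x \<in> carrier (submodule_of M N)"
    then have "\<ominus>\<^bsub>M\<^esub> x \<in> N"
      using N.m_inv_closed[of x] by (simp add: a_inv_def)
    moreover have "\<ominus>\<^bsub>M\<^esub> x \<oplus>\<^bsub>M\<^esub> x = \<zero>\<^bsub>M\<^esub>"
      using x sub by (intro M.l_neg) auto
    ultimately show "\<exists>y\<in>carrier (submodule_of M N).
        y \<oplus>\<^bsub>submodule_of M N\<^esub> x = \<zero>\<^bsub>submodule_of M N\<^esub>"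
      by auto
  next
    show "\<zero>\<^bsub>submodule_of M N\<^esub> \<in> carrier (submodule_of M N)"
      using N.one_closed by simp
  next
    fix x y
    assume "x \<in> carrier (submodule_of M N)" "y \<in> carrier (submodule_of M N)"
    then show "x \<oplus>\<^bsub>submodule_of M N\<^esub> y \<in> carrier (submodule_of M N)"
      using N.m_closed[of x y] by simp
  qed (use sub in \<open>simp_all add: M.a_ac subsetD\<close>)
  with sub show ?thesis
    by (intro right_module.intro right_module_axioms.intro)
      (auto simp: R.ring_axioms smult_l_distr smult_r_distr smult_assoc N.smult_closed subsetD)
qed

lemma (in right_module) quotient_smult:
  assumes "submodule N R M" "r \<in> carrier R" "x \<in> carrier M"
  shows "r \<odot>\<^bsub>quotient_module M N\<^esub> (N +>\<^bsub>M\<^esub> x) = N +>\<^bsub>M\<^esub> (r \<odot>\<^bsub>M\<^esub> x)"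
proof -
  interpret N: submodule N R M by fact
  have sub: "N \<subseteq> carrier M" using N.subset by simp
  interpret A: abelian_subgroup N M
    by (rule abelian_subgroupI3) (auto intro: additive_subgroup.intro N.subgroup_axioms
        M.abelian_group_axioms)
  have "N +>\<^bsub>M\<^esub> (r \<odot>\<^bsub>M\<^esub> (n \<oplus>\<^bsub>M\<^esub> x)) = N +>\<^bsub>M\<^esub> (r \<odot>\<^bsub>M\<^esub> x)" if n: "n \<in> N" for n
  proof (rule M.a_repr_independence[symmetric])
    have "r \<odot>\<^bsub>M\<^esub> (n \<oplus>\<^bsub>M\<^esub> x) = r \<odot>\<^bsub>M\<^esub> n \<oplus>\<^bsub>M\<^esub> r \<odot>\<^bsub>M\<^esub> x"
      using assms n sub by (auto simp: smult_r_distr)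
    then show "r \<odot>\<^bsub>M\<^esub> (n \<oplus>\<^bsub>M\<^esub> x) \<in> N +>\<^bsub>M\<^esub> (r \<odot>\<^bsub>M\<^esub> x)"
      using N.smult_closed[of r n] assms n by (auto simp: a_r_coset_def')
  qed (use assms N.subgroup_axioms in auto)
  moreover have "N \<noteq> {}" using N.subgroup_axioms N.one_closed empty_iff by metis
  ultimately show ?thesis
    by (auto simp: quotient_module_def a_r_coset_def'[of M N x])
qed

lemma (in right_module) right_module_quotient:
  assumes N: "submodule N R M"
  shows "right_module R (quotient_module M N)"
proof -
  interpret N: submodule N R M by fact
  interpret A: abelian_subgroup N M
    by (rule abelian_subgroupI3) (auto intro: additive_subgroup.intro N.subgroup_axioms
        M.abelian_group_axioms)
  let ?Q = "quotient_module M N"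
  have car: "carrier ?Q = (\<lambda>x. N +>\<^bsub>M\<^esub> x) ` carrier M"
    by (auto simp: quotient_module_def A_RCOSETS_def')
  have add: "(N +>\<^bsub>M\<^esub> x) \<oplus>\<^bsub>?Q\<^esub> (N +>\<^bsub>M\<^esub> y) = N +>\<^bsub>M\<^esub> (x \<oplus>\<^bsub>M\<^esub> y)"
    if "x \<in> carrier M" "y \<in> carrier M" for x y
    using A.a_rcos_sum[OF that] by (simp add: quotient_module_def)
  have zero: "\<zero>\<^bsub>?Q\<^esub> = N +>\<^bsub>M\<^esub> \<zero>\<^bsub>M\<^esub>"
    using M.a_coset_add_zero[OF A.a_subset] by (simp add: quotient_module_def)
  have "abelian_group ?Q"
  proof (rule abelian_groupI)
    fix X assume "X \<in> carrier ?Q"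
    then obtain x where "x \<in> carrier M" "X = N +>\<^bsub>M\<^esub> x" by (auto simp: car)
    then show "\<exists>Y\<in>carrier ?Q. Y \<oplus>\<^bsub>?Q\<^esub> X = \<zero>\<^bsub>?Q\<^esub>"
      by (intro bexI[of _ "N +>\<^bsub>M\<^esub> (\<ominus>\<^bsub>M\<^esub> x)"]) (auto simp: car add zero M.l_neg)
  qed (auto simp: car add zero M.a_ac)
  then show ?thesis
    by (intro right_module.intro right_module_axioms.intro)
      (auto simp: R.ring_axioms car add quotient_smult[OF N] smult_l_distr smult_r_distr smult_assoc)
qed

end

theory Submission
  imports Defs
begin

text \<open>
  The main point is to decompose an injective module \<open>E\<close> over a right max-\<open>QF\<close> ring.
  Let \<open>E1\<close> be the intersection of the kernels of all homomorphisms \<open>E \<rightarrow> R\<close>.  For a submodule \<open>K\<close> and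
  a maximal \<open>C\<close> with \<open>K \<inter> C = 0\<close>, every \<open>e \<in> E\<close> is carried into \<open>K \<oplus> C\<close> by an essential right ideal.
  With \<open>K = E1\<close>, extend the projection \<open>K \<oplus> C \<rightarrow> K\<close> to \<open>g : E \<rightarrow> E\<close>; nonsingularity forces all
  homomorphisms into \<open>R\<close> to vanish on \<open>g E\<close>, so \<open>g\<close> is a retraction onto \<open>E1\<close>, and
  \<open>E = E1 \<oplus> E2\<close> with \<open>E2 = ker g\<close>.  If \<open>E1\<close> had a maximal submodule, max-projectivity would give a
  nonzero homomorphism \<open>E1 \<rightarrow> R\<close>, contradicting the choice of \<open>E1\<close>.

  \<open>E2\<close> is injective and torsionless.  The same essentiality argument with \<open>K = ker h\<close> shows that
  every \<open>h : E2 \<rightarrow> R\<close> admits \<open>x\<close> with \<open>h (x h(e)) = h e\<close> for all \<open>e\<close>, so \<open>e \<mapsto> x h(e)\<close> is a projection onto a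
  projective summand.  To lift a homomorphism from \<open>E2\<close> along a surjection, take by Zorn a maximal
  partial lift with injective domain \<open>V\<close>; Noetherianness makes unions of chains of injective
  submodules injective.  If \<open>V \<noteq> E2\<close>, some \<open>h \<noteq> 0\<close> vanishes on \<open>V\<close>, and the lift extends over the
  corresponding summand.

  Conversely, a homomorphism \<open>E1 \<rightarrow> R/I\<close> with \<open>Rad E1 = E1\<close> vanishes, because its image is
  Noetherian; together with a lift on the projective part \<open>E2\<close> this gives \<open>R\<close>-projectivity.
\<close>

section \<open>Submodules and homomorphisms\<close>

text \<open>Zorn's lemma for families of sets given by a predicate, as an elimination rule. It
  serves to build maximal complements, maximal extensions and maximal partial lifts.\<close>

lemma Zorn_predicate:
  assumes "P A"
    and Union: "\<And>\<C>. \<C> \<noteq> {} \<Longrightarrow> (\<And>C. C \<in> \<C> \<Longrightarrow> P C) \<Longrightarrow>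
      (\<And>C D. C \<in> \<C> \<Longrightarrow> D \<in> \<C> \<Longrightarrow> C \<subseteq> D \<or> D \<subseteq> C) \<Longrightarrow> P (\<Union>\<C>)"
  obtains M where "P M" "\<And>X. P X \<Longrightarrow> M \<subseteq> X \<Longrightarrow> X = M"
proof -
  have "\<exists>M\<in>Collect P. \<forall>X\<in>Collect P. M \<subseteq> X \<longrightarrow> X = M"
  proof (rule subset_Zorn_nonempty)
    show "Collect P \<noteq> {}" using assms(1) by auto
    show "\<Union>\<C> \<in> Collect P" if "\<C> \<noteq> {}" "subset.chain (Collect P) \<C>" for \<C>
      using that Union[of \<C>] by (auto simp: subset_chain_def)
  qed
  then show thesis using that by auto
qed

lemma module_homI:
  assumes "\<And>x. x \<in> carrier M \<Longrightarrow> f x \<in> carrier N"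
    and "\<And>x y. x \<in> carrier M \<Longrightarrow> y \<in> carrier M \<Longrightarrow> f (x \<oplus>\<^bsub>M\<^esub> y) = f x \<oplus>\<^bsub>N\<^esub> f y"
    and "\<And>r x. r \<in> carrier R \<Longrightarrow> x \<in> carrier M \<Longrightarrow> f (r \<odot>\<^bsub>M\<^esub> x) = r \<odot>\<^bsub>N\<^esub> f x"
  shows "f \<in> module_hom R M N"
  using assms by (auto simp: module_hom_def)

lemma module_hom_closed: "f \<in> module_hom R M N \<Longrightarrow> x \<in> carrier M \<Longrightarrow> f x \<in> carrier N"
  by (simp add: module_hom_def Pi_iff)

lemma module_hom_add:
  "f \<in> module_hom R M N \<Longrightarrow> x \<in> carrier M \<Longrightarrow> y \<in> carrier M \<Longrightarrow> f (x \<oplus>\<^bsub>M\<^esub> y) = f x \<oplus>\<^bsub>N\<^esub> f y"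
  by (simp add: module_hom_def)

lemma module_hom_smult:
  "f \<in> module_hom R M N \<Longrightarrow> r \<in> carrier R \<Longrightarrow> x \<in> carrier M \<Longrightarrow> f (r \<odot>\<^bsub>M\<^esub> x) = r \<odot>\<^bsub>N\<^esub> f x"
  by (simp add: module_hom_def)

lemmas module_homD = module_hom_closed module_hom_add module_hom_smult

lemma module_hom_id: "(\<lambda>x. x) \<in> module_hom R M M"
  by (simp add: module_hom_def)

lemma module_hom_comp:
  "f \<in> module_hom R L M \<Longrightarrow> g \<in> module_hom R M N \<Longrightarrow> (\<lambda>x. g (f x)) \<in> module_hom R L N"
  by (simp add: module_hom_def Pi_iff)

lemma module_hom_restrict:
  "f \<in> module_hom R M N \<Longrightarrow> A \<subseteq> carrier M \<Longrightarrow> f \<in> module_hom R (submodule_of M A) N"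
  by (simp add: module_hom_def Pi_iff subset_iff)

lemma module_hom_into:
  "f \<in> module_hom R M N \<Longrightarrow> f ` carrier M \<subseteq> B \<Longrightarrow> f \<in> module_hom R M (submodule_of N B)"
  by (simp add: module_hom_def image_subset_iff Pi_iff)

lemma module_hom_from:
  "f \<in> module_hom R M (submodule_of N B) \<Longrightarrow> B \<subseteq> carrier N \<Longrightarrow> f \<in> module_hom R M N"
  by (simp add: module_hom_def Pi_iff subset_iff)

lemma submoduleD:
  assumes "submodule N R M"
  shows submodule_subset: "N \<subseteq> carrier M"
    and submodule_zero: "\<zero>\<^bsub>M\<^esub> \<in> N"
    and submodule_add: "x \<in> N \<Longrightarrow> y \<in> N \<Longrightarrow> x \<oplus>\<^bsub>M\<^esub> y \<in> N"
    and submodule_smult: "r \<in> carrier R \<Longrightarrow> x \<in> N \<Longrightarrow> r \<odot>\<^bsub>M\<^esub> x \<in> N"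
    and submodule_neg: "x \<in> N \<Longrightarrow> \<ominus>\<^bsub>M\<^esub> x \<in> N"
    and submodule_minus: "x \<in> N \<Longrightarrow> y \<in> N \<Longrightarrow> x \<ominus>\<^bsub>M\<^esub> y \<in> N"
proof -
  interpret N: submodule N R M by fact
  show "N \<subseteq> carrier M" using N.subset by simp
  show "\<zero>\<^bsub>M\<^esub> \<in> N" using N.one_closed by simp
  show "x \<in> N \<Longrightarrow> y \<in> N \<Longrightarrow> x \<oplus>\<^bsub>M\<^esub> y \<in> N" using N.m_closed[of x y] by simp
  show "r \<in> carrier R \<Longrightarrow> x \<in> N \<Longrightarrow> r \<odot>\<^bsub>M\<^esub> x \<in> N" by (rule N.smult_closed)
  show neg: "x \<in> N \<Longrightarrow> \<ominus>\<^bsub>M\<^esub> x \<in> N" for x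
    using N.m_inv_closed[of x] by (simp add: a_inv_def)
  show "x \<in> N \<Longrightarrow> y \<in> N \<Longrightarrow> x \<ominus>\<^bsub>M\<^esub> y \<in> N"
    using N.m_closed[of x "\<ominus>\<^bsub>M\<^esub> y"] neg[of y] by (simp add: a_minus_def)
qed

section \<open>Subtraction in abelian groups\<close>

context abelian_group
begin

lemma a_minus_eq_zero_iff:
  "x \<in> carrier G \<Longrightarrow> y \<in> carrier G \<Longrightarrow> x \<ominus> y = \<zero> \<longleftrightarrow> x = y"
  by (metis a_minus_def local.minus_minus minus_equality r_neg a_inv_closed a_comm)

lemma a_minus_add_cancel: "x \<in> carrier G \<Longrightarrow> y \<in> carrier G \<Longrightarrow> (x \<ominus> y) \<oplus> y = x"
  by (simp add: a_minus_def a_assoc l_neg)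

lemma a_add_minus_cancel: "x \<in> carrier G \<Longrightarrow> y \<in> carrier G \<Longrightarrow> (x \<oplus> y) \<ominus> y = x"
  by (simp add: a_minus_def a_assoc r_neg)

lemma eq_a_minus_iff:
  "x \<in> carrier G \<Longrightarrow> y \<in> carrier G \<Longrightarrow> z \<in> carrier G \<Longrightarrow> x = y \<ominus> z \<longleftrightarrow> y = x \<oplus> z"
  using a_minus_add_cancel a_add_minus_cancel by metis

lemma a_minus_add_distrib:
  "\<lbrakk>x \<in> carrier G; y \<in> carrier G; u \<in> carrier G; v \<in> carrier G\<rbrakk> \<Longrightarrow>
    (x \<oplus> y) \<ominus> (u \<oplus> v) = (x \<ominus> u) \<oplus> (y \<ominus> v)"
  by (simp add: a_minus_def minus_add a_ac)

end

section \<open>Scalar arithmetic and constructions of submodules\<close>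

context right_module
begin

lemma zero_smult [simp]:
  assumes "x \<in> carrier M"
  shows "\<zero> \<odot>\<^bsub>M\<^esub> x = \<zero>\<^bsub>M\<^esub>"
proof -
  have "\<zero> \<odot>\<^bsub>M\<^esub> x \<oplus>\<^bsub>M\<^esub> \<zero> \<odot>\<^bsub>M\<^esub> x = \<zero> \<odot>\<^bsub>M\<^esub> x"
    using smult_l_distr[of \<zero> \<zero> x] assms by simp
  then show ?thesis using assms by simp
qed

lemma smult_zero [simp]:
  assumes "r \<in> carrier R"
  shows "r \<odot>\<^bsub>M\<^esub> \<zero>\<^bsub>M\<^esub> = \<zero>\<^bsub>M\<^esub>"
proof -
  have "r \<odot>\<^bsub>M\<^esub> \<zero>\<^bsub>M\<^esub> \<oplus>\<^bsub>M\<^esub> r \<odot>\<^bsub>M\<^esub> \<zero>\<^bsub>M\<^esub> = r \<odot>\<^bsub>M\<^esub> \<zero>\<^bsub>M\<^esub>"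
    using smult_r_distr[of r "\<zero>\<^bsub>M\<^esub>" "\<zero>\<^bsub>M\<^esub>"] assms by simp
  then show ?thesis using assms by simp
qed

lemma smult_neg:
  assumes "r \<in> carrier R" "x \<in> carrier M"
  shows "r \<odot>\<^bsub>M\<^esub> (\<ominus>\<^bsub>M\<^esub> x) = \<ominus>\<^bsub>M\<^esub> (r \<odot>\<^bsub>M\<^esub> x)"
proof (rule M.minus_equality[symmetric])
  show "r \<odot>\<^bsub>M\<^esub> (\<ominus>\<^bsub>M\<^esub> x) \<oplus>\<^bsub>M\<^esub> r \<odot>\<^bsub>M\<^esub> x = \<zero>\<^bsub>M\<^esub>"
    using smult_r_distr[of r "\<ominus>\<^bsub>M\<^esub> x" x] assms by (simp add: M.l_neg)
qed (use assms in auto)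

lemma neg_smult:
  assumes "r \<in> carrier R" "x \<in> carrier M"
  shows "(\<ominus> r) \<odot>\<^bsub>M\<^esub> x = \<ominus>\<^bsub>M\<^esub> (r \<odot>\<^bsub>M\<^esub> x)"
proof (rule M.minus_equality[symmetric])
  show "(\<ominus> r) \<odot>\<^bsub>M\<^esub> x \<oplus>\<^bsub>M\<^esub> r \<odot>\<^bsub>M\<^esub> x = \<zero>\<^bsub>M\<^esub>"
    using smult_l_distr[of "\<ominus> r" r x] assms by (simp add: R.l_neg)
qed (use assms in auto)

lemma smult_r_minus:
  "\<lbrakk>r \<in> carrier R; x \<in> carrier M; y \<in> carrier M\<rbrakk> \<Longrightarrow>
    r \<odot>\<^bsub>M\<^esub> (x \<ominus>\<^bsub>M\<^esub> y) = r \<odot>\<^bsub>M\<^esub> x \<ominus>\<^bsub>M\<^esub> r \<odot>\<^bsub>M\<^esub> y"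
  by (simp add: a_minus_def smult_r_distr smult_neg)

lemma smult_l_minus:
  "\<lbrakk>r \<in> carrier R; s \<in> carrier R; x \<in> carrier M\<rbrakk> \<Longrightarrow>
    (r \<ominus> s) \<odot>\<^bsub>M\<^esub> x = r \<odot>\<^bsub>M\<^esub> x \<ominus>\<^bsub>M\<^esub> s \<odot>\<^bsub>M\<^esub> x"
  by (simp add: a_minus_def smult_l_distr neg_smult)

text \<open>Negation is multiplication by the scalar -1, so closure under additive inverses follows
  from closure under scalars.\<close>

lemma submoduleI:
  assumes "N \<subseteq> carrier M" "\<zero>\<^bsub>M\<^esub> \<in> N"
    and "\<And>x y. x \<in> N \<Longrightarrow> y \<in> N \<Longrightarrow> x \<oplus>\<^bsub>M\<^esub> y \<in> N"
    and "\<And>r x. r \<in> carrier R \<Longrightarrow> x \<in> N \<Longrightarrow> r \<odot>\<^bsub>M\<^esub> x \<in> N"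
  shows "submodule N R M"
proof (intro submodule.intro subgroup.intro submodule_axioms.intro)
  fix x assume x: "x \<in> N"
  have "\<ominus>\<^bsub>M\<^esub> x = (\<ominus> \<one>) \<odot>\<^bsub>M\<^esub> x"
    using x assms(1) by (subst neg_smult) auto
  then show "inv\<^bsub>add_monoid M\<^esub> x \<in> N"
    using assms(4)[OF _ x, of "\<ominus> \<one>"] by (simp add: a_inv_def)
qed (use assms in auto)

lemma submodule_carrier: "submodule (carrier M) R M"
  by (rule submoduleI) auto

lemma submodule_singleton_zero: "submodule {\<zero>\<^bsub>M\<^esub>} R M"
  by (rule submoduleI) auto

lemma submodule_trans:
  assumes N: "submodule N R M" and A: "submodule A R (submodule_of M N)"
  shows "submodule A R M"
  using submodule_subset[OF A] submodule_subset[OF N] submodule_zero[OF A]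
    submodule_add[OF A] submodule_smult[OF A]
  by (intro submoduleI) auto

lemma submodule_chain_Union:
  assumes "\<C> \<noteq> {}" and "\<And>N. N \<in> \<C> \<Longrightarrow> submodule N R M"
    and "\<And>N K. N \<in> \<C> \<Longrightarrow> K \<in> \<C> \<Longrightarrow> N \<subseteq> K \<or> K \<subseteq> N"
  shows "submodule (\<Union>\<C>) R M"
proof (rule submoduleI)
  fix x y assume "x \<in> \<Union>\<C>" "y \<in> \<Union>\<C>"
  then obtain N K where NK: "N \<in> \<C>" "K \<in> \<C>" "x \<in> N" "y \<in> K" by auto
  then have "x \<in> K \<or> y \<in> N" using assms(3)[OF NK(1,2)] by auto
  then show "x \<oplus>\<^bsub>M\<^esub> y \<in> \<Union>\<C>"
    using NK submodule_add[OF assms(2)] by blast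
next
  show "\<zero>\<^bsub>M\<^esub> \<in> \<Union>\<C>" using assms(1) submodule_zero[OF assms(2)] by blast
next
  show "\<Union>\<C> \<subseteq> carrier M" using submodule_subset[OF assms(2)] by (rule Union_least)
next
  fix r x assume "r \<in> carrier R" "x \<in> \<Union>\<C>"
  then show "r \<odot>\<^bsub>M\<^esub> x \<in> \<Union>\<C>" using submodule_smult[OF assms(2)] by blast
qed

text \<open>This is N + xR, the smallest enlargement of a submodule N that contains x. Maximality
  arguments test against it.\<close>

definition adjoin :: "'b set \<Rightarrow> 'b \<Rightarrow> 'b set"
  where "adjoin N x = {n \<oplus>\<^bsub>M\<^esub> r \<odot>\<^bsub>M\<^esub> x | n r. n \<in> N \<and> r \<in> carrier R}"

lemma adjoinI: "n \<in> N \<Longrightarrow> r \<in> carrier R \<Longrightarrow> n \<oplus>\<^bsub>M\<^esub> r \<odot>\<^bsub>M\<^esub> x \<in> adjoin N x"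
  by (auto simp: adjoin_def)

lemma adjoinE:
  assumes "z \<in> adjoin N x"
  obtains n r where "n \<in> N" "r \<in> carrier R" "z = n \<oplus>\<^bsub>M\<^esub> r \<odot>\<^bsub>M\<^esub> x"
  using assms by (auto simp: adjoin_def)

lemma submodule_adjoin:
  assumes N: "submodule N R M" and x: "x \<in> carrier M"
  shows "submodule (adjoin N x) R M" "N \<subseteq> adjoin N x" "x \<in> adjoin N x"
proof -
  note [simp] = subsetD[OF submodule_subset[OF N]] x
  show subset: "N \<subseteq> adjoin N x"
  proof
    fix n assume "n \<in> N"
    then show "n \<in> adjoin N x" using adjoinI[of n N \<zero> x] by simp
  qed
  show "x \<in> adjoin N x"
    using adjoinI[OF submodule_zero[OF N], of \<one> x] by simp
  show "submodule (adjoin N x) R M"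
  proof (rule submoduleI)
    show "adjoin N x \<subseteq> carrier M" by (auto elim!: adjoinE)
    show "\<zero>\<^bsub>M\<^esub> \<in> adjoin N x" using subset submodule_zero[OF N] by blast
  next
    fix u v assume "u \<in> adjoin N x" "v \<in> adjoin N x"
    then obtain n r n' r' where *: "n \<in> N" "r \<in> carrier R" "u = n \<oplus>\<^bsub>M\<^esub> r \<odot>\<^bsub>M\<^esub> x"
      "n' \<in> N" "r' \<in> carrier R" "v = n' \<oplus>\<^bsub>M\<^esub> r' \<odot>\<^bsub>M\<^esub> x" by (elim adjoinE)
    then have "u \<oplus>\<^bsub>M\<^esub> v = (n \<oplus>\<^bsub>M\<^esub> n') \<oplus>\<^bsub>M\<^esub> (r \<oplus> r') \<odot>\<^bsub>M\<^esub> x"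
      by (simp add: smult_l_distr M.a_ac)
    then show "u \<oplus>\<^bsub>M\<^esub> v \<in> adjoin N x"
      using * by (simp add: adjoinI submodule_add[OF N])
  next
    fix s u assume s: "s \<in> carrier R" and "u \<in> adjoin N x"
    then obtain n r where *: "n \<in> N" "r \<in> carrier R" "u = n \<oplus>\<^bsub>M\<^esub> r \<odot>\<^bsub>M\<^esub> x"
      by (elim adjoinE)
    then have "s \<odot>\<^bsub>M\<^esub> u = s \<odot>\<^bsub>M\<^esub> n \<oplus>\<^bsub>M\<^esub> (r \<otimes> s) \<odot>\<^bsub>M\<^esub> x"
      using s by (simp add: smult_r_distr smult_assoc)
    then show "s \<odot>\<^bsub>M\<^esub> u \<in> adjoin N x"
      using * s by (simp add: adjoinI submodule_smult[OF N])
  qed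
qed

text \<open>Zorn applies because the union of a nonempty chain of submodules meeting K trivially
  again meets K trivially. Such a C makes K + C essential, which is how it is used.\<close>

lemma maximal_disjoint_submodule:
  assumes "submodule K R M"
  obtains C where "submodule C R M" "C \<inter> K = {\<zero>\<^bsub>M\<^esub>}"
    "\<And>D. submodule D R M \<Longrightarrow> D \<inter> K = {\<zero>\<^bsub>M\<^esub>} \<Longrightarrow> C \<subseteq> D \<Longrightarrow> D = C"
proof -
  have "\<exists>C. (submodule C R M \<and> C \<inter> K = {\<zero>\<^bsub>M\<^esub>}) \<and>
      (\<forall>D. submodule D R M \<and> D \<inter> K = {\<zero>\<^bsub>M\<^esub>} \<longrightarrow> C \<subseteq> D \<longrightarrow> D = C)"
  proof (rule Zorn_predicate[of "\<lambda>C. submodule C R M \<and> C \<inter> K = {\<zero>\<^bsub>M\<^esub>}" "{\<zero>\<^bsub>M\<^esub>}"])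
    show "submodule {\<zero>\<^bsub>M\<^esub>} R M \<and> {\<zero>\<^bsub>M\<^esub>} \<inter> K = {\<zero>\<^bsub>M\<^esub>}"
      using submodule_singleton_zero submodule_zero[OF assms] by simp
  next
    fix \<C> assume "\<C> \<noteq> {}" and \<C>: "\<And>C. C \<in> \<C> \<Longrightarrow> submodule C R M \<and> C \<inter> K = {\<zero>\<^bsub>M\<^esub>}"
      and "\<And>C D. C \<in> \<C> \<Longrightarrow> D \<in> \<C> \<Longrightarrow> C \<subseteq> D \<or> D \<subseteq> C"
    then have "submodule (\<Union>\<C>) R M" by (intro submodule_chain_Union) simp_all
    moreover have "\<Union>\<C> \<inter> K = {\<zero>\<^bsub>M\<^esub>}" using \<open>\<C> \<noteq> {}\<close> \<C> by blast
    ultimately show "submodule (\<Union>\<C>) R M \<and> \<Union>\<C> \<inter> K = {\<zero>\<^bsub>M\<^esub>}" by simp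
  qed blast
  then show thesis using that by metis
qed

end

section \<open>Arithmetic of homomorphisms, images and preimages\<close>

lemma right_module_hom_zero:
  assumes "right_module R M" "right_module R N" "f \<in> module_hom R M N"
  shows "f \<zero>\<^bsub>M\<^esub> = \<zero>\<^bsub>N\<^esub>"
proof -
  interpret M: right_module R M by fact
  interpret N: right_module R N by fact
  have "f (\<zero>\<^bsub>R\<^esub> \<odot>\<^bsub>M\<^esub> \<zero>\<^bsub>M\<^esub>) = \<zero>\<^bsub>R\<^esub> \<odot>\<^bsub>N\<^esub> f \<zero>\<^bsub>M\<^esub>"
    using assms(3) by (intro module_hom_smult) auto
  then show ?thesis using module_hom_closed[OF assms(3)] by simp
qed

lemma right_module_hom_minus:
  assumes "right_module R M" "right_module R N" "f \<in> module_hom R M N"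
    and x: "x \<in> carrier M" and y: "y \<in> carrier M"
  shows "f (x \<ominus>\<^bsub>M\<^esub> y) = f x \<ominus>\<^bsub>N\<^esub> f y"
proof -
  interpret M: right_module R M by fact
  interpret N: right_module R N by fact
  have "f (x \<ominus>\<^bsub>M\<^esub> y) \<oplus>\<^bsub>N\<^esub> f y = f x"
    using module_hom_add[OF assms(3), of "x \<ominus>\<^bsub>M\<^esub> y" y] x y
    by (simp add: M.a_minus_add_cancel)
  then show ?thesis
    using x y module_hom_closed[OF assms(3)] by (subst N.eq_a_minus_iff) auto
qed

lemma module_hom_plus:
  assumes "right_module R N" "f \<in> module_hom R M N" "g \<in> module_hom R M N"
  shows "(\<lambda>x. f x \<oplus>\<^bsub>N\<^esub> g x) \<in> module_hom R M N"
proof -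
  interpret N: right_module R N by fact
  show ?thesis
    by (intro module_homI)
      (simp_all add: module_homD[OF assms(2)] module_homD[OF assms(3)] N.M.a_ac N.smult_r_distr)
qed

lemma module_hom_diff:
  assumes "right_module R N" "f \<in> module_hom R M N" "g \<in> module_hom R M N"
  shows "(\<lambda>x. f x \<ominus>\<^bsub>N\<^esub> g x) \<in> module_hom R M N"
proof -
  interpret N: right_module R N by fact
  show ?thesis
    by (intro module_homI) (simp_all add: module_homD[OF assms(2)] module_homD[OF assms(3)]
        N.a_minus_add_distrib N.smult_r_minus)
qed

lemma regular_module_simps [simp]:
  "carrier (regular_module R) = carrier R"
  "zero (regular_module R) = zero R"
  "add (regular_module R) = add R"
  "r \<odot>\<^bsub>regular_module R\<^esub> x = x \<otimes>\<^bsub>R\<^esub> r"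
  "a_inv (regular_module R) = a_inv R"
  "a_minus (regular_module R) = a_minus R"
  by (simp_all add: regular_module_def a_inv_def a_minus_def m_inv_def fun_eq_iff)

lemma (in right_module) module_hom_orbit:
  "x \<in> carrier M \<Longrightarrow> (\<lambda>r. r \<odot>\<^bsub>M\<^esub> x) \<in> module_hom R (regular_module R) M"
  by (rule module_homI) (auto simp: smult_l_distr smult_assoc)

lemma submodule_image:
  assumes "right_module R M" "right_module R N" "f \<in> module_hom R M N" "submodule A R M"
  shows "submodule (f ` A) R N"
proof -
  interpret M: right_module R M by fact
  interpret N: right_module R N by fact
  note A = submoduleD[OF assms(4)]
  have in_M: "x \<in> A \<Longrightarrow> x \<in> carrier M" for x using A(1) by blast
  show ?thesis
  proof (rule N.submoduleI)
    show "\<zero>\<^bsub>N\<^esub> \<in> f ` A"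
      using right_module_hom_zero[OF assms(1-3)] A(2) by force
  next
    fix x y assume "x \<in> f ` A" "y \<in> f ` A"
    then show "x \<oplus>\<^bsub>N\<^esub> y \<in> f ` A"
      using module_hom_add[OF assms(3) in_M in_M, symmetric] A(3) by auto
  next
    fix r x assume "r \<in> carrier R" "x \<in> f ` A"
    then show "r \<odot>\<^bsub>N\<^esub> x \<in> f ` A"
      using module_hom_smult[OF assms(3) _ in_M, symmetric] A(4) by auto
  qed (use module_hom_closed[OF assms(3) in_M] in auto)
qed

lemma submodule_vimage:
  assumes "right_module R M" "right_module R N" "f \<in> module_hom R M N" "submodule B R N"
  shows "submodule {x \<in> carrier M. f x \<in> B} R M"
proof -
  interpret M: right_module R M by fact
  show ?thesis
    by (intro M.submoduleI) (auto simp: module_homD[OF assms(3)]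
        right_module_hom_zero[OF assms(1-3)] submoduleD[OF assms(4)])
qed

section \<open>Partial homomorphisms as submodules of a product\<close>

text \<open>The factors may have different carrier types. The product is the ambient module for
  graphs of partial homomorphisms, and it also serves as an external direct sum from which maps on
  sums are defined.\<close>

definition prod_module ::
    "('a, 'b, 's) module_scheme \<Rightarrow> ('a, 'c, 't) module_scheme \<Rightarrow> ('a, 'b \<times> 'c) module"
  where "prod_module M N =
    \<lparr>carrier = carrier M \<times> carrier N, mult = undefined, one = undefined,
     zero = (\<zero>\<^bsub>M\<^esub>, \<zero>\<^bsub>N\<^esub>), add = (\<lambda>p q. (fst p \<oplus>\<^bsub>M\<^esub> fst q, snd p \<oplus>\<^bsub>N\<^esub> snd q)),
     smult = (\<lambda>r p. (r \<odot>\<^bsub>M\<^esub> fst p, r \<odot>\<^bsub>N\<^esub> snd p))\<rparr>"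

lemma prod_module_simps [simp]:
  "carrier (prod_module M N) = carrier M \<times> carrier N"
  "zero (prod_module M N) = (\<zero>\<^bsub>M\<^esub>, \<zero>\<^bsub>N\<^esub>)"
  "p \<oplus>\<^bsub>prod_module M N\<^esub> q = (fst p \<oplus>\<^bsub>M\<^esub> fst q, snd p \<oplus>\<^bsub>N\<^esub> snd q)"
  "r \<odot>\<^bsub>prod_module M N\<^esub> p = (r \<odot>\<^bsub>M\<^esub> fst p, r \<odot>\<^bsub>N\<^esub> snd p)"
  by (simp_all add: prod_module_def)

lemma right_module_prod:
  assumes "right_module R M" "right_module R N"
  shows "right_module R (prod_module M N)"
proof -
  interpret M: right_module R M by fact
  interpret N: right_module R N by fact
  have "abelian_group (prod_module M N)"
  proof (rule abelian_groupI)
    fix p assume "p \<in> carrier (prod_module M N)"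
    then show "\<exists>q\<in>carrier (prod_module M N). q \<oplus>\<^bsub>prod_module M N\<^esub> p = \<zero>\<^bsub>prod_module M N\<^esub>"
      by (intro bexI[of _ "(\<ominus>\<^bsub>M\<^esub> fst p, \<ominus>\<^bsub>N\<^esub> snd p)"]) (auto simp: M.M.l_neg N.M.l_neg)
  qed (auto simp: M.M.a_ac N.M.a_ac)
  then show ?thesis
    by (intro right_module.intro right_module_axioms.intro)
      (auto simp: M.R.ring_axioms M.smult_l_distr M.smult_r_distr M.smult_assoc
        N.smult_l_distr N.smult_r_distr N.smult_assoc)
qed

lemma module_hom_fst: "fst \<in> module_hom R (prod_module M N) M"
  by (simp add: module_hom_def Pi_iff)

lemma module_hom_snd: "snd \<in> module_hom R (prod_module M N) N"
  by (simp add: module_hom_def Pi_iff)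

lemma module_hom_Pair:
  "f \<in> module_hom R L M \<Longrightarrow> g \<in> module_hom R L N \<Longrightarrow>
    (\<lambda>x. (f x, g x)) \<in> module_hom R L (prod_module M N)"
  by (simp add: module_hom_def Pi_iff)

text \<open>Graphs of homomorphisms from submodules of M to N. For a submodule of the product,
  single-valuedness need only be required over zero. Extension of maps becomes inclusion of graphs,
  which suits Zorn's lemma.\<close>

definition partial_hom ::
    "('a, 'r) ring_scheme \<Rightarrow> ('a, 'b, 's) module_scheme \<Rightarrow> ('a, 'c, 't) module_scheme \<Rightarrow>
      ('b \<times> 'c) set \<Rightarrow> bool"
  where "partial_hom R M N G \<longleftrightarrow>
    submodule G R (prod_module M N) \<and> (\<forall>y. (\<zero>\<^bsub>M\<^esub>, y) \<in> G \<longrightarrow> y = \<zero>\<^bsub>N\<^esub>)"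

text \<open>The assignment f(x) \<mapsto> g(x) on the image of f is well defined because the kernel
  of f lies in the kernel of g. Its graph is the image of the map (f, g).\<close>

lemma partial_hom_image_Pair:
  assumes "right_module R L" "right_module R M" "right_module R N"
    and f: "f \<in> module_hom R L M" and g: "g \<in> module_hom R L N"
    and ker: "\<And>x. x \<in> carrier L \<Longrightarrow> f x = \<zero>\<^bsub>M\<^esub> \<Longrightarrow> g x = \<zero>\<^bsub>N\<^esub>"
  shows "partial_hom R M N ((\<lambda>x. (f x, g x)) ` carrier L)"
  unfolding partial_hom_def
  using submodule_image[OF assms(1) right_module_prod[OF assms(2,3)] module_hom_Pair[OF f g]
      right_module.submodule_carrier[OF assms(1)]] ker
  by auto

lemma partial_hom_graph:
  assumes M: "right_module R M" and N: "right_module R N" and A: "submodule A R M"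
    and f: "f \<in> module_hom R (submodule_of M A) N"
  shows "partial_hom R M N ((\<lambda>x. (x, f x)) ` A)"
proof -
  have "(\<lambda>x. x) \<in> module_hom R (submodule_of M A) M"
    by (rule module_hom_restrict[OF module_hom_id submodule_subset[OF A]])
  moreover have "f \<zero>\<^bsub>M\<^esub> = \<zero>\<^bsub>N\<^esub>"
    using right_module_hom_zero[OF right_module.right_module_submodule[OF M A] N f] by simp
  ultimately show ?thesis
    using partial_hom_image_Pair[OF right_module.right_module_submodule[OF M A] M N _ f] by simp
qed

lemma partial_hom_Union:
  assumes "right_module R M" "right_module R N" "\<C> \<noteq> {}"
    and "\<And>G. G \<in> \<C> \<Longrightarrow> partial_hom R M N G"
    and "\<And>G H. G \<in> \<C> \<Longrightarrow> H \<in> \<C> \<Longrightarrow> G \<subseteq> H \<or> H \<subseteq> G"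
  shows "partial_hom R M N (\<Union>\<C>)"
  using right_module.submodule_chain_Union[OF right_module_prod[OF assms(1,2)] assms(3) _ assms(5)]
    assms(4)
  unfolding partial_hom_def by blast

lemma partial_hom_domain:
  assumes "right_module R M" "right_module R N" "partial_hom R M N G"
  shows "submodule (fst ` G) R M"
  using assms by (auto simp: partial_hom_def
      intro: submodule_image[OF right_module_prod _ module_hom_fst])

text \<open>Passes from a graph back to a function: two values over the same point differ by a value
  over zero, hence agree.\<close>

lemma partial_hom_apply:
  assumes M: "right_module R M" and N: "right_module R N" and G: "partial_hom R M N G"
  obtains f where "f \<in> module_hom R (submodule_of M (fst ` G)) N"
    and "\<And>x y. (x, y) \<in> G \<Longrightarrow> f x = y" and "\<And>x. x \<in> fst ` G \<Longrightarrow> (x, f x) \<in> G"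
proof -
  interpret M: right_module R M by fact
  interpret N: right_module R N by fact
  interpret P: right_module R "prod_module M N"
    using M N by (rule right_module_prod)
  have sub: "submodule G R (prod_module M N)" and zero: "\<And>y. (\<zero>\<^bsub>M\<^esub>, y) \<in> G \<Longrightarrow> y = \<zero>\<^bsub>N\<^esub>"
    using G by (auto simp: partial_hom_def)
  have unique: "y = y'" if "(x, y) \<in> G" "(x, y') \<in> G" for x y y'
  proof -
    have car: "x \<in> carrier M" "y \<in> carrier N" "y' \<in> carrier N"
      using that submodule_subset[OF sub] by auto
    have "(\<ominus>\<^bsub>R\<^esub> \<one>\<^bsub>R\<^esub>) \<odot>\<^bsub>prod_module M N\<^esub> (x, y') \<in> G"
      using that(2) by (intro submodule_smult[OF sub]) auto
    \<comment> \<open>Adding (x, y) and -(x, y') leaves a pair over zero.\<close>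
    from submodule_add[OF sub that(1) this] have "(\<zero>\<^bsub>M\<^esub>, y \<ominus>\<^bsub>N\<^esub> y') \<in> G"
      using car by (simp add: M.neg_smult N.neg_smult M.M.r_neg a_minus_def)
    then show ?thesis using zero N.M.a_minus_eq_zero_iff[OF car(2,3)] by auto
  qed
  define f where "f x = (THE y. (x, y) \<in> G)" for x
  have f: "f x = y" if "(x, y) \<in> G" for x y
    unfolding f_def using that unique by blast
  have mem: "(x, f x) \<in> G" if "x \<in> fst ` G" for x
    using that f by force
  have hom: "f \<in> module_hom R (submodule_of M (fst ` G)) N"
  proof (rule module_homI)
    fix x assume "x \<in> carrier (submodule_of M (fst ` G))"
    then show "f x \<in> carrier N" using mem submodule_subset[OF sub] by force
  next
    fix x y
    assume "x \<in> carrier (submodule_of M (fst ` G))" "y \<in> carrier (submodule_of M (fst ` G))"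
    then have "(x, f x) \<in> G" "(y, f y) \<in> G" using mem by auto
    from submodule_add[OF sub this] f
    show "f (x \<oplus>\<^bsub>submodule_of M (fst ` G)\<^esub> y) = f x \<oplus>\<^bsub>N\<^esub> f y" by simp
  next
    fix r x assume "r \<in> carrier R" "x \<in> carrier (submodule_of M (fst ` G))"
    then have "r \<in> carrier R" "(x, f x) \<in> G" using mem by auto
    from submodule_smult[OF sub this] f
    show "f (r \<odot>\<^bsub>submodule_of M (fst ` G)\<^esub> x) = r \<odot>\<^bsub>N\<^esub> f x" by simp
  qed
  show thesis by (rule that[OF hom f mem])
qed

section \<open>Baer's criterion\<close>

text \<open>Multiplication by x is the general form of a homomorphism R \<rightarrow> E, with x the
  image of 1, so this is extendability from right ideals to R. Being free of test modules, the
  condition passes easily to summands and, over Noetherian rings, to unions of chains.\<close>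

definition baer :: "('a, 'r) ring_scheme \<Rightarrow> ('a, 'b, 's) module_scheme \<Rightarrow> bool"
  where "baer R E \<longleftrightarrow>
    (\<forall>J. right_ideal R J \<longrightarrow>
      (\<forall>f\<in>module_hom R (submodule_of (regular_module R) J) E.
        \<exists>x\<in>carrier E. \<forall>r\<in>J. f r = r \<odot>\<^bsub>E\<^esub> x))"

lemma baerD:
  assumes "baer R E" "right_ideal R J"
    and "f \<in> module_hom R (submodule_of (regular_module R) J) E"
  obtains x where "x \<in> carrier E" "\<And>r. r \<in> J \<Longrightarrow> f r = r \<odot>\<^bsub>E\<^esub> x"
  using assms unfolding baer_def by metis

lemma baer_extend:
  assumes E: "right_module R E" "baer R E" and B: "right_module R B"
    and A: "submodule A R B" and f: "f \<in> module_hom R (submodule_of B A) E"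
  obtains h where "h \<in> module_hom R B E" "\<And>x. x \<in> A \<Longrightarrow> h x = f x"
proof -
  interpret E: right_module R E by fact
  interpret B: right_module R B by fact
  interpret P: right_module R "prod_module B E"
    using B E(1) by (rule right_module_prod)
  interpret Reg: right_module R "regular_module R"
    by (rule right_module_regular) (rule E.R.ring_axioms)
  obtain G where GA: "partial_hom R B E G \<and> (\<lambda>x. (x, f x)) ` A \<subseteq> G"
    and max: "\<And>H. partial_hom R B E H \<and> (\<lambda>x. (x, f x)) ` A \<subseteq> H \<Longrightarrow> G \<subseteq> H \<Longrightarrow> H = G"
  proof (rule Zorn_predicate[of "\<lambda>G. partial_hom R B E G \<and> (\<lambda>x. (x, f x)) ` A \<subseteq> G"])
    show "partial_hom R B E ((\<lambda>x. (x, f x)) ` A) \<and> (\<lambda>x. (x, f x)) ` A \<subseteq> (\<lambda>x. (x, f x)) ` A"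
      using partial_hom_graph[OF B E(1) A f] by simp
  next
    fix \<C> assume "\<C> \<noteq> {}"
      and \<C>: "\<And>G. G \<in> \<C> \<Longrightarrow> partial_hom R B E G \<and> (\<lambda>x. (x, f x)) ` A \<subseteq> G"
      and "\<And>G H. G \<in> \<C> \<Longrightarrow> H \<in> \<C> \<Longrightarrow> G \<subseteq> H \<or> H \<subseteq> G"
    then have "partial_hom R B E (\<Union>\<C>)"
      by (intro partial_hom_Union[OF B E(1)]) simp_all
    moreover have "(\<lambda>x. (x, f x)) ` A \<subseteq> \<Union>\<C>" using \<open>\<C> \<noteq> {}\<close> \<C> by blast
    ultimately show "partial_hom R B E (\<Union>\<C>) \<and> (\<lambda>x. (x, f x)) ` A \<subseteq> \<Union>\<C>" by simp
  qed metis
  then have G: "partial_hom R B E G" and fG: "(\<lambda>x. (x, f x)) ` A \<subseteq> G" by simp_all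
  have sub: "submodule G R (prod_module B E)" using G by (simp add: partial_hom_def)
  let ?D = "fst ` G"
  note D = partial_hom_domain[OF B E(1) G]
  obtain u where u: "u \<in> module_hom R (submodule_of B ?D) E"
    and u_eq: "\<And>x y. (x, y) \<in> G \<Longrightarrow> u x = y" and u_mem: "\<And>x. x \<in> ?D \<Longrightarrow> (x, u x) \<in> G"
    using partial_hom_apply[OF B E(1) G] by blast
  have "b \<in> ?D" if b: "b \<in> carrier B" for b
  proof -
    let ?J = "{r \<in> carrier (regular_module R). r \<odot>\<^bsub>B\<^esub> b \<in> ?D}"
    have J: "right_ideal R ?J" unfolding right_ideal_def
      by (rule submodule_vimage[OF Reg.right_module_axioms B B.module_hom_orbit[OF b] D])
    have "(\<lambda>r. r \<odot>\<^bsub>B\<^esub> b) \<in> module_hom R (submodule_of (regular_module R) ?J) (submodule_of B ?D)"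
      by (rule module_hom_into[OF module_hom_restrict[OF B.module_hom_orbit[OF b]]]) auto
    then obtain x
      where x: "x \<in> carrier E" and ux: "\<And>r. r \<in> ?J \<Longrightarrow> u (r \<odot>\<^bsub>B\<^esub> b) = r \<odot>\<^bsub>E\<^esub> x"
      by (rule baerD[OF E(2) J module_hom_comp[OF _ u]]) blast
    have bx: "(b, x) \<in> carrier (prod_module B E)" using b x by simp
    \<comment> \<open>If v + b r = 0 with v in the domain, then b r = -v is in the domain too. Hence
      x r = u(b r), and the value u(v) + x r equals u(0) = 0.\<close>
    have H: "partial_hom R B E (P.adjoin G (b, x))"
      unfolding partial_hom_def
    proof (intro conjI allI impI)
      show "submodule (P.adjoin G (b, x)) R (prod_module B E)"
        by (rule P.submodule_adjoin[OF sub bx])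
      fix w assume "(\<zero>\<^bsub>B\<^esub>, w) \<in> P.adjoin G (b, x)"
      then obtain v y r where vy: "(v, y) \<in> G" and r: "r \<in> carrier R"
        and eq: "\<zero>\<^bsub>B\<^esub> = v \<oplus>\<^bsub>B\<^esub> r \<odot>\<^bsub>B\<^esub> b" "w = y \<oplus>\<^bsub>E\<^esub> r \<odot>\<^bsub>E\<^esub> x"
        by (auto elim!: P.adjoinE)
      have v: "v \<in> ?D" "v \<in> carrier B" using vy submodule_subset[OF D] by force+
      have "r \<odot>\<^bsub>B\<^esub> b = \<ominus>\<^bsub>B\<^esub> v"
        using eq(1) v r b by (intro B.M.minus_equality[symmetric]) (auto simp: B.M.a_comm)
      then have rb: "r \<odot>\<^bsub>B\<^esub> b \<in> ?D" using submodule_neg[OF D v(1)] by simp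
      have "w = u v \<oplus>\<^bsub>E\<^esub> u (r \<odot>\<^bsub>B\<^esub> b)"
        using eq(2) u_eq[OF vy] ux[of r] rb r by simp
      also have "\<dots> = u \<zero>\<^bsub>B\<^esub>"
        using module_hom_add[OF u, of v "r \<odot>\<^bsub>B\<^esub> b"] v rb eq(1) by simp
      also have "\<dots> = \<zero>\<^bsub>E\<^esub>"
        using u_eq submodule_zero[OF sub] by simp
      finally show "w = \<zero>\<^bsub>E\<^esub>" .
    qed
    have "P.adjoin G (b, x) = G"
      using max H fG P.submodule_adjoin(2)[OF sub bx] by simp
    then have "(b, x) \<in> G" using P.submodule_adjoin(3)[OF sub bx] by simp
    then show ?thesis by force
  qed
  then have "?D = carrier B" using submodule_subset[OF D] by blast
  with u have "u \<in> module_hom R B E" by (simp add: module_hom_def)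
  moreover have "u x = f x" if "x \<in> A" for x using fG that u_eq by auto
  ultimately show thesis by (rule that)
qed

text \<open>If x represents a map f into V, then so does p(x), since p fixes the values f(r) = x
  r.\<close>

lemma baer_retract:
  assumes M: "right_module R M" "baer R M" and V: "submodule V R M"
    and p: "p \<in> module_hom R M M" "p ` carrier M \<subseteq> V" "\<And>v. v \<in> V \<Longrightarrow> p v = v"
  shows "baer R (submodule_of M V)"
  unfolding baer_def
proof (intro allI impI ballI)
  interpret M: right_module R M by fact
  fix J f assume J: "right_ideal R J"
    and f: "f \<in> module_hom R (submodule_of (regular_module R) J) (submodule_of M V)"
  obtain x where x: "x \<in> carrier M" "\<And>r. r \<in> J \<Longrightarrow> f r = r \<odot>\<^bsub>M\<^esub> x"
    using baerD[OF M(2) J module_hom_from[OF f submodule_subset[OF V]]] by metis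
  have "f r = r \<odot>\<^bsub>M\<^esub> p x" if r: "r \<in> J" for r
  proof -
    have "r \<in> carrier R" using J r submodule_subset by (force simp: right_ideal_def)
    then have "r \<odot>\<^bsub>M\<^esub> p x = p (r \<odot>\<^bsub>M\<^esub> x)" using module_hom_smult[OF p(1)] x(1) by simp
    moreover have "p (f r) = f r" using p(3) module_hom_closed[OF f] r by simp
    ultimately show ?thesis using x(2)[OF r] by simp
  qed
  then show "\<exists>x\<in>carrier (submodule_of M V). \<forall>r\<in>J. f r = r \<odot>\<^bsub>submodule_of M V\<^esub> x"
    using x(1) p(2) by auto
qed

text \<open>The retraction is an extension of the identity of V along the inclusion of V in
  M.\<close>

lemma baer_submodule_retraction:
  assumes "right_module R M" "submodule V R M" "baer R (submodule_of M V)"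
  obtains p where "p \<in> module_hom R M M" "p ` carrier M \<subseteq> V" "\<And>v. v \<in> V \<Longrightarrow> p v = v"
proof -
  interpret M: right_module R M by fact
  obtain p where p: "p \<in> module_hom R M (submodule_of M V)" "\<And>v. v \<in> V \<Longrightarrow> p v = v"
    using baer_extend[OF M.right_module_submodule[OF assms(2)] assms(3,1,2) module_hom_id]
    by auto
  show thesis
    using that[OF module_hom_from[OF p(1) submodule_subset[OF assms(2)]]]
      module_hom_closed[OF p(1)] p(2) by auto
qed

text \<open>Starting point for the Zorn argument on partial lifts: zero represents every map into
  the zero module.\<close>

lemma baer_zero:
  assumes "right_module R M" shows "baer R (submodule_of M {\<zero>\<^bsub>M\<^esub>})"
proof -
  interpret M: right_module R M by fact
  show ?thesis
    using submodule_subset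
    by (fastforce simp: baer_def right_ideal_def module_hom_def subset_iff)
qed

text \<open>Without a maximal member, iterating a choice of strictly larger members would produce a
  strictly ascending sequence of right ideals.\<close>

lemma noetherian_maximal:
  assumes noeth: "right_noetherian R" and "\<J> \<noteq> {}" and ri: "\<And>J. J \<in> \<J> \<Longrightarrow> right_ideal R J"
  obtains J where "J \<in> \<J>" "\<And>K. K \<in> \<J> \<Longrightarrow> J \<subseteq> K \<Longrightarrow> K = J"
proof (rule ccontr)
  assume "\<not> thesis"
  with that have step: "\<exists>K\<in>\<J>. J \<subset> K" if "J \<in> \<J>" for J using that by blast
  then obtain s where s: "\<And>J. J \<in> \<J> \<Longrightarrow> s J \<in> \<J> \<and> J \<subset> s J" by metis
  obtain J0 where J0: "J0 \<in> \<J>" using assms(2) by auto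
  define I where "I n = (s ^^ n) J0" for n
  have I: "I n \<in> \<J>" for n by (induction n) (auto simp: I_def J0 s)
  have lt: "I n \<subset> I (Suc n)" for n using s[OF I[of n]] by (simp add: I_def)
  with I ri noeth obtain n where n: "\<forall>m\<ge>n. I m = I n"
    unfolding right_noetherian_def by (metis psubset_imp_subset)
  have "I (Suc n) = I n" by (rule n[rule_format]) simp
  then show False using lt[of n] by simp
qed

text \<open>A map f from a right ideal J to the union already lands in one member of the chain. In
  place of generators of J, the argument uses a maximal one among the right ideals formed by all r
  in J with f(r) in V.\<close>

lemma baer_chain_Union:
  assumes M: "right_module R M" and noeth: "right_noetherian R" and "\<C> \<noteq> {}"
    and sub: "\<And>V. V \<in> \<C> \<Longrightarrow> submodule V R M"
    and chain: "\<And>V W. V \<in> \<C> \<Longrightarrow> W \<in> \<C> \<Longrightarrow> V \<subseteq> W \<or> W \<subseteq> V"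
    and baer: "\<And>V. V \<in> \<C> \<Longrightarrow> baer R (submodule_of M V)"
  shows "baer R (submodule_of M (\<Union>\<C>))"
  unfolding baer_def
proof (intro allI impI ballI)
  interpret M: right_module R M by fact
  interpret Reg: right_module R "regular_module R"
    by (rule right_module_regular) (rule M.R.ring_axioms)
  fix J f assume J: "right_ideal R J"
    and f: "f \<in> module_hom R (submodule_of (regular_module R) J) (submodule_of M (\<Union>\<C>))"
  have J': "submodule J R (regular_module R)" using J by (simp add: right_ideal_def)
  have U: "\<Union>\<C> \<subseteq> carrier M" using sub submodule_subset by blast
  let ?P = "\<lambda>V. {r \<in> J. f r \<in> V}"
  have P: "right_ideal R (?P V)" if V: "V \<in> \<C>" for V
    unfolding right_ideal_def
    using submodule_vimage[OF Reg.right_module_submodule[OF J'] M module_hom_from[OF f U] sub[OF V]]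
    by (intro Reg.submodule_trans[OF J']) simp
  obtain V where V: "V \<in> \<C>" and max: "\<And>W. W \<in> \<C> \<Longrightarrow> ?P V \<subseteq> ?P W \<Longrightarrow> ?P W = ?P V"
  proof (rule noetherian_maximal[OF noeth, of "?P ` \<C>"])
    show "?P ` \<C> \<noteq> {}" using \<open>\<C> \<noteq> {}\<close> by simp
    show "right_ideal R J" if "J \<in> ?P ` \<C>" for J using that P by auto
  qed (use that in auto)
  \<comment> \<open>The value f(r) lies in some W. If W contains V, then by maximality W and V have
    the same preimage, so f(r) lies in V.\<close>
  have fV: "f r \<in> V" if r: "r \<in> J" for r
  proof -
    obtain W where W: "W \<in> \<C>" "f r \<in> W" using module_hom_closed[OF f, of r] r by auto
    consider "V \<subseteq> W" | "W \<subseteq> V" using chain[OF V W(1)] by blast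
    then show ?thesis
    proof cases
      case 1
      then have "?P W = ?P V" using max[OF W(1)] by blast
      then show ?thesis using W(2) r by blast
    qed (use W in blast)
  qed
  then have "f \<in> module_hom R (submodule_of (regular_module R) J) (submodule_of M V)"
    using f by (simp add: module_hom_def Pi_iff)
  then obtain x where "x \<in> V" "\<And>r. r \<in> J \<Longrightarrow> f r = r \<odot>\<^bsub>M\<^esub> x"
    by (rule baerD[OF baer[OF V] J]) simp
  then show "\<exists>x\<in>carrier (submodule_of M (\<Union>\<C>)). \<forall>r\<in>J. f r = r \<odot>\<^bsub>submodule_of M (\<Union>\<C>)\<^esub> x"
    using V by auto
qed

section \<open>Torsionless injective modules over nonsingular rings\<close>

context right_module
begin

section \<open>Sums of submodules and essential right ideals\<close>

lemma set_addI: "k \<in> K \<Longrightarrow> c \<in> C \<Longrightarrow> k \<oplus>\<^bsub>M\<^esub> c \<in> K <+>\<^bsub>M\<^esub> C"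
  by (auto simp: set_add_def')

lemma set_addE:
  assumes "x \<in> K <+>\<^bsub>M\<^esub> C"
  obtains k c where "k \<in> K" "c \<in> C" "x = k \<oplus>\<^bsub>M\<^esub> c"
  using assms by (auto simp: set_add_def')

lemma submodule_set_add:
  assumes K: "submodule K R M" and C: "submodule C R M"
  shows "submodule (K <+>\<^bsub>M\<^esub> C) R M"
proof -
  note [simp] = subsetD[OF submodule_subset[OF K]] subsetD[OF submodule_subset[OF C]]
  show ?thesis
  proof (rule submoduleI)
    show "K <+>\<^bsub>M\<^esub> C \<subseteq> carrier M" by (auto simp: set_add_def')
    show "\<zero>\<^bsub>M\<^esub> \<in> K <+>\<^bsub>M\<^esub> C"
      using submodule_zero[OF K] submodule_zero[OF C] by (force simp: set_add_def')
  next
    fix x y assume "x \<in> K <+>\<^bsub>M\<^esub> C" "y \<in> K <+>\<^bsub>M\<^esub> C"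
    then obtain k c k' c' where *: "k \<in> K" "c \<in> C" "k' \<in> K" "c' \<in> C"
      "x = k \<oplus>\<^bsub>M\<^esub> c" "y = k' \<oplus>\<^bsub>M\<^esub> c'" by (elim set_addE)
    then have "x \<oplus>\<^bsub>M\<^esub> y = (k \<oplus>\<^bsub>M\<^esub> k') \<oplus>\<^bsub>M\<^esub> (c \<oplus>\<^bsub>M\<^esub> c')" by (simp add: M.a_ac)
    with * show "x \<oplus>\<^bsub>M\<^esub> y \<in> K <+>\<^bsub>M\<^esub> C"
      by (simp add: set_addI submodule_add[OF K] submodule_add[OF C])
  next
    fix r x assume r: "r \<in> carrier R" and "x \<in> K <+>\<^bsub>M\<^esub> C"
    then obtain k c where *: "k \<in> K" "c \<in> C" "x = k \<oplus>\<^bsub>M\<^esub> c" by (elim set_addE)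
    then have "r \<odot>\<^bsub>M\<^esub> x = r \<odot>\<^bsub>M\<^esub> k \<oplus>\<^bsub>M\<^esub> r \<odot>\<^bsub>M\<^esub> c" using r by (simp add: smult_r_distr)
    with * r show "r \<odot>\<^bsub>M\<^esub> x \<in> K <+>\<^bsub>M\<^esub> C"
      by (simp add: set_addI submodule_smult[OF K] submodule_smult[OF C])
  qed
qed

lemma right_module_regular': "right_module R (regular_module R)"
  by (rule right_module_regular) (rule R.ring_axioms)

text \<open>A sum k + c = 0 forces k and c to lie in the zero intersection. Hence the value u(k) +
  v(c) depends only on k + c.\<close>

lemma disjoint_sum_hom:
  assumes K: "submodule K R M" and C: "submodule C R M" and dis: "C \<inter> K = {\<zero>\<^bsub>M\<^esub>}"
    and N: "right_module R N"
    and u: "u \<in> module_hom R (submodule_of M K) N" and v: "v \<in> module_hom R (submodule_of M C) N"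
  obtains f where "f \<in> module_hom R (submodule_of M (K <+>\<^bsub>M\<^esub> C)) N"
    "\<And>k c. k \<in> K \<Longrightarrow> c \<in> C \<Longrightarrow> f (k \<oplus>\<^bsub>M\<^esub> c) = u k \<oplus>\<^bsub>N\<^esub> v c"
proof -
  note C_car = subsetD[OF submodule_subset[OF C]]
  note K_car = subsetD[OF submodule_subset[OF K]]
  note modK = right_module_submodule[OF K] and modC = right_module_submodule[OF C]
  interpret N: right_module R N by (rule N)
  let ?L = "prod_module (submodule_of M K) (submodule_of M C)"
  let ?sum = "\<lambda>p. fst p \<oplus>\<^bsub>M\<^esub> snd p" and ?val = "\<lambda>p. u (fst p) \<oplus>\<^bsub>N\<^esub> v (snd p)"
  have L: "right_module R ?L" by (rule right_module_prod[OF modK modC])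
  have sum: "?sum \<in> module_hom R ?L M"
    by (rule module_hom_plus[OF right_module_axioms
          module_hom_from[OF module_hom_fst submodule_subset[OF K]]
          module_hom_from[OF module_hom_snd submodule_subset[OF C]]])
  have val: "?val \<in> module_hom R ?L N"
    by (rule module_hom_plus[OF N module_hom_comp[OF module_hom_fst u]
          module_hom_comp[OF module_hom_snd v]])
  let ?G = "(\<lambda>p. (?sum p, ?val p)) ` carrier ?L"
  have G: "partial_hom R M N ?G"
  proof (rule partial_hom_image_Pair[OF L right_module_axioms N sum val])
    fix p assume "p \<in> carrier ?L" and sum0: "fst p \<oplus>\<^bsub>M\<^esub> snd p = \<zero>\<^bsub>M\<^esub>"
    then have p: "fst p \<in> K" "snd p \<in> C" by auto
    then have "fst p = \<ominus>\<^bsub>M\<^esub> snd p"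
      using K_car C_car sum0 by (auto intro: M.minus_equality[symmetric])
    then have "fst p \<in> C \<inter> K" using submodule_neg[OF C] p by auto
    then have "fst p = \<zero>\<^bsub>M\<^esub>" using dis by simp
    moreover from this have "snd p = \<zero>\<^bsub>M\<^esub>" using sum0 C_car p(2) by simp
    ultimately show "u (fst p) \<oplus>\<^bsub>N\<^esub> v (snd p) = \<zero>\<^bsub>N\<^esub>"
      using right_module_hom_zero[OF modK N u] right_module_hom_zero[OF modC N v] by simp
  qed
  have dom: "fst ` ?G = K <+>\<^bsub>M\<^esub> C"
    by (force simp: set_add_def' image_iff)
  obtain f where f: "f \<in> module_hom R (submodule_of M (fst ` ?G)) N"
    and f_eq: "\<And>x y. (x, y) \<in> ?G \<Longrightarrow> f x = y"
    and "\<And>x. x \<in> fst ` ?G \<Longrightarrow> (x, f x) \<in> ?G"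
    by (rule partial_hom_apply[OF right_module_axioms N G], rule that)
  have "f (k \<oplus>\<^bsub>M\<^esub> c) = u k \<oplus>\<^bsub>N\<^esub> v c" if "k \<in> K" "c \<in> C" for k c
    by (rule f_eq, rule image_eqI[of _ _ "(k, c)"]) (use that in auto)
  with f show thesis unfolding dom by (rule that)
qed

text \<open>Modulo a complement, \<open>K\<close> is essential: every \<open>e\<close> is carried into \<open>K \<oplus> C\<close> by an essential
  right ideal.\<close>

lemma essential_colon_ideal:
  assumes K: "submodule K R M" and C: "submodule C R M" "C \<inter> K = {\<zero>\<^bsub>M\<^esub>}"
    and max: "\<And>D. submodule D R M \<Longrightarrow> D \<inter> K = {\<zero>\<^bsub>M\<^esub>} \<Longrightarrow> C \<subseteq> D \<Longrightarrow> D = C"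
    and e: "e \<in> carrier M"
  shows "essential_right_ideal R {r \<in> carrier R. r \<odot>\<^bsub>M\<^esub> e \<in> K <+>\<^bsub>M\<^esub> C}"
    (is "essential_right_ideal R ?I")
  unfolding essential_right_ideal_def
proof (intro conjI allI impI)
  show "right_ideal R ?I"
    using submodule_vimage[OF right_module_regular' right_module_axioms module_hom_orbit[OF e]
        submodule_set_add[OF K C(1)]]
    by (simp add: right_ideal_def)
  fix J assume "right_ideal R J \<and> J \<noteq> {\<zero>}"
  then have J: "submodule J R (regular_module R)" and "J \<noteq> {\<zero>}" by (auto simp: right_ideal_def)
  moreover have "\<zero> \<in> J" using submodule_zero[OF J] by simp
  ultimately obtain s where s: "s \<in> J" "s \<noteq> \<zero>" by auto
  have s_car: "s \<in> carrier R" using submodule_subset[OF J] s by auto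
  note K_car = subsetD[OF submodule_subset[OF K]]
  note C_car = subsetD[OF submodule_subset[OF C(1)]]
  have "\<exists>r\<in>?I \<inter> J. r \<noteq> \<zero>"
  proof (cases "s \<odot>\<^bsub>M\<^esub> e \<in> C")
    case True
    have "\<zero>\<^bsub>M\<^esub> \<oplus>\<^bsub>M\<^esub> s \<odot>\<^bsub>M\<^esub> e \<in> K <+>\<^bsub>M\<^esub> C"
      by (rule set_addI[OF submodule_zero[OF K] True])
    then show ?thesis using s s_car e by auto
  next
    case False
    have se: "s \<odot>\<^bsub>M\<^esub> e \<in> carrier M" using s_car e by simp
    \<comment> \<open>As e s is not in C, the submodule C + (e s)R is strictly larger than C and by
      maximality contains some nonzero k in K. From k = c + e s t one gets e s t = k - c in K + C,
      so s t is the element sought.\<close>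
    note ad = submodule_adjoin[OF C(1) se]
    have "adjoin C (s \<odot>\<^bsub>M\<^esub> e) \<inter> K \<noteq> {\<zero>\<^bsub>M\<^esub>}"
      using max[OF ad(1) _ ad(2)] ad(3) False by metis
    moreover have "\<zero>\<^bsub>M\<^esub> \<in> adjoin C (s \<odot>\<^bsub>M\<^esub> e) \<inter> K"
      using submodule_zero[OF ad(1)] submodule_zero[OF K] by simp
    ultimately obtain k where k: "k \<in> K" "k \<noteq> \<zero>\<^bsub>M\<^esub>" "k \<in> adjoin C (s \<odot>\<^bsub>M\<^esub> e)" by auto
    from k(3) obtain c t where c: "c \<in> C" and t: "t \<in> carrier R"
      and kc: "k = c \<oplus>\<^bsub>M\<^esub> t \<odot>\<^bsub>M\<^esub> (s \<odot>\<^bsub>M\<^esub> e)" by (rule adjoinE)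
    have r: "(s \<otimes> t) \<odot>\<^bsub>M\<^esub> e = t \<odot>\<^bsub>M\<^esub> (s \<odot>\<^bsub>M\<^esub> e)" using s_car t e by (simp add: smult_assoc)
    have "(s \<otimes> t) \<odot>\<^bsub>M\<^esub> e = k \<ominus>\<^bsub>M\<^esub> c"
      using kc C_car[OF c] se t K_car[OF k(1)]
      by (subst M.eq_a_minus_iff) (auto simp: r M.a_comm)
    also have "\<dots> \<in> K <+>\<^bsub>M\<^esub> C"
      unfolding a_minus_def by (rule set_addI[OF k(1) submodule_neg[OF C(1) c]])
    finally have "s \<otimes> t \<in> ?I" using s_car t by simp
    moreover have "s \<otimes> t \<in> J" using submodule_smult[OF J t s(1)] by simp
    \<comment> \<open>If s t were zero, then k = c would lie in both C and K and hence
      vanish.\<close>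
    moreover have "s \<otimes> t \<noteq> \<zero>"
    proof
      assume "s \<otimes> t = \<zero>"
      then have "t \<odot>\<^bsub>M\<^esub> (s \<odot>\<^bsub>M\<^esub> e) = \<zero>\<^bsub>M\<^esub>" using r e by simp
      then have "k = c" using kc C_car[OF c] by simp
      then show False using k(1,2) c C(2) by auto
    qed
    ultimately show ?thesis by blast
  qed
  then show "?I \<inter> J \<noteq> {\<zero>}" by auto
qed

end

section \<open>Consequences of nonsingularity for Baer modules\<close>

lemma right_nonsingularD:
  assumes "right_nonsingular R" "essential_right_ideal R I" "d \<in> carrier R"
    and "\<And>x. x \<in> I \<Longrightarrow> d \<otimes>\<^bsub>R\<^esub> x = \<zero>\<^bsub>R\<^esub>"
  shows "d = \<zero>\<^bsub>R\<^esub>"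
  using assms unfolding right_nonsingular_def by metis

context right_module
begin

text \<open>On a complement C of the kernel, h is injective, and its inverse h(C) \<rightarrow> M is
  multiplication by some x. So the identity holds on C, and nonsingularity carries it to all of M.
  It says that h(x) is idempotent with h(M) = h(x)R, and that e \<mapsto> x h(e) is a projection of
  M with the same kernel as h.\<close>

lemma hom_regular_idempotent:
  assumes ns: "right_nonsingular R" and baer: "baer R M"
    and h: "h \<in> module_hom R M (regular_module R)"
  obtains x where "x \<in> carrier M" "\<And>e. e \<in> carrier M \<Longrightarrow> h (h e \<odot>\<^bsub>M\<^esub> x) = h e"
proof -
  note reg = right_module_regular'
  interpret Reg: right_module R "regular_module R" by (rule reg)
  note h_closed = module_hom_closed[OF h, simplified]
  note h_add = module_hom_add[OF h, simplified]
  note h_smult = module_hom_smult[OF h, simplified]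
  let ?K = "{e \<in> carrier M. h e \<in> {\<zero>\<^bsub>regular_module R\<^esub>}}"
  have K: "submodule ?K R M"
    by (rule submodule_vimage[OF right_module_axioms reg h Reg.submodule_singleton_zero])
  obtain C where C: "submodule C R M" "C \<inter> ?K = {\<zero>\<^bsub>M\<^esub>}"
    and max: "\<And>D. submodule D R M \<Longrightarrow> D \<inter> ?K = {\<zero>\<^bsub>M\<^esub>} \<Longrightarrow> C \<subseteq> D \<Longrightarrow> D = C"
    by (rule maximal_disjoint_submodule[OF K], rule that)
  note C_car = subsetD[OF submodule_subset[OF C(1)]]
  have inj: "inj_on h C"
  proof (rule inj_onI)
    fix c c' assume c: "c \<in> C" "c' \<in> C" "h c = h c'"
    have "h (c \<ominus>\<^bsub>M\<^esub> c') = h c \<ominus> h c'"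
      using right_module_hom_minus[OF right_module_axioms reg h C_car C_car] c by simp
    also have "\<dots> = \<zero>"
      using c h_closed[OF C_car] by (simp add: R.a_minus_eq_zero_iff)
    finally have "c \<ominus>\<^bsub>M\<^esub> c' \<in> C \<inter> ?K"
      using submodule_minus[OF C(1) c(1,2)] C_car c by auto
    then show "c = c'" using C(2) C_car c M.a_minus_eq_zero_iff[of c c'] by auto
  qed
  let ?f = "inv_into C h"
  have f: "?f (h c) = c" if "c \<in> C" for c using inj that by simp
  have "right_ideal R (h ` C)"
    unfolding right_ideal_def by (rule submodule_image[OF right_module_axioms reg h C(1)])
  moreover have "?f \<in> module_hom R (submodule_of (regular_module R) (h ` C)) M"
  proof (rule module_homI)
    fix a b
    assume "a \<in> carrier (submodule_of (regular_module R) (h ` C))"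
      "b \<in> carrier (submodule_of (regular_module R) (h ` C))"
    then obtain c d where "a = h c" "b = h d" and cd: "c \<in> C" "d \<in> C" by auto
    then show "?f (a \<oplus>\<^bsub>submodule_of (regular_module R) (h ` C)\<^esub> b) = ?f a \<oplus>\<^bsub>M\<^esub> ?f b"
      using f[OF submodule_add[OF C(1) cd]] f by (simp add: h_add C_car)
  next
    fix r a
    assume r: "r \<in> carrier R" and "a \<in> carrier (submodule_of (regular_module R) (h ` C))"
    then obtain c where "a = h c" and c: "c \<in> C" by auto
    then show "?f (r \<odot>\<^bsub>submodule_of (regular_module R) (h ` C)\<^esub> a) = r \<odot>\<^bsub>M\<^esub> ?f a"
      using f[OF submodule_smult[OF C(1) r c]] f r by (simp add: h_smult C_car)
  qed (auto simp: f C_car)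
  ultimately obtain x where x: "x \<in> carrier M" and fx: "\<And>r. r \<in> h ` C \<Longrightarrow> ?f r = r \<odot>\<^bsub>M\<^esub> x"
    by (rule baerD[OF baer]) blast
  have hx: "h c \<odot>\<^bsub>M\<^esub> x = c" if "c \<in> C" for c using fx[of "h c"] f[OF that] that by simp
  have "h (h e \<odot>\<^bsub>M\<^esub> x) = h e" if e: "e \<in> carrier M" for e
  proof -
    note he = h_closed[OF e]
    have hhe: "h (h e \<odot>\<^bsub>M\<^esub> x) \<in> carrier R" using h_closed he x by simp
    \<comment> \<open>This difference annihilates the essential right ideal of all r with e r in K +
      C: if e r = k + c, then h(e) r = h(c), and x h(c) = c.\<close>
    have "h (h e \<odot>\<^bsub>M\<^esub> x) \<ominus> h e = \<zero>"
    proof (rule right_nonsingularD[OF ns essential_colon_ideal[OF K C max e]])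
      fix r assume "r \<in> {r \<in> carrier R. r \<odot>\<^bsub>M\<^esub> e \<in> ?K <+>\<^bsub>M\<^esub> C}"
      then obtain k c where r: "r \<in> carrier R" and k: "k \<in> ?K" and c: "c \<in> C"
        and eq: "r \<odot>\<^bsub>M\<^esub> e = k \<oplus>\<^bsub>M\<^esub> c" by (auto elim: set_addE)
      have "h e \<otimes> r = h (r \<odot>\<^bsub>M\<^esub> e)" using h_smult[OF r e] by simp
      also have "\<dots> = h c" using eq k c h_closed[OF C_car[OF c]] by (simp add: h_add C_car)
      finally have her: "h e \<otimes> r = h c" .
      have "h (h e \<odot>\<^bsub>M\<^esub> x) \<otimes> r = h ((h e \<otimes> r) \<odot>\<^bsub>M\<^esub> x)"
        using h_smult[OF r, of "h e \<odot>\<^bsub>M\<^esub> x"] he x r by (simp add: smult_assoc)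
      also have "\<dots> = h e \<otimes> r" using her hx[OF c] by simp
      finally show "(h (h e \<odot>\<^bsub>M\<^esub> x) \<ominus> h e) \<otimes> r = \<zero>"
        using he hhe r by (simp add: a_minus_def R.l_distr R.l_minus R.r_neg)
    qed (use he hhe in auto)
    then show ?thesis using he hhe by (simp add: R.a_minus_eq_zero_iff)
  qed
  with x show thesis by (rule that)
qed

text \<open>K is the reject of R in M, the common kernel of all maps to R. This makes it a direct
  summand, with g the retraction.\<close>

lemma reject_retraction:
  assumes ns: "right_nonsingular R" and baer: "baer R M"
  defines "K \<equiv> {e \<in> carrier M. \<forall>h\<in>module_hom R M (regular_module R). h e = \<zero>}"
  obtains g where "submodule K R M" "g \<in> module_hom R M M" "g ` carrier M \<subseteq> K"
    "\<And>k. k \<in> K \<Longrightarrow> g k = k"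
proof -
  note reg = right_module_regular'
  have h_zero: "h \<zero>\<^bsub>M\<^esub> = \<zero>" if "h \<in> module_hom R M (regular_module R)" for h
    using right_module_hom_zero[OF right_module_axioms reg that] by simp
  have K: "submodule K R M"
  proof (rule submoduleI)
    show "K \<subseteq> carrier M" "\<zero>\<^bsub>M\<^esub> \<in> K" by (auto simp: K_def h_zero)
    have K_car: "x \<in> carrier M" if "x \<in> K" for x using that by (simp add: K_def)
    have K_hom: "h x = \<zero>" if "h \<in> module_hom R M (regular_module R)" "x \<in> K" for h x
      using that by (simp add: K_def)
    show "x \<oplus>\<^bsub>M\<^esub> y \<in> K" if "x \<in> K" "y \<in> K" for x y
      unfolding K_def using that by (simp add: module_hom_add K_hom K_car)
    show "r \<odot>\<^bsub>M\<^esub> x \<in> K" if "r \<in> carrier R" "x \<in> K" for r x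
      unfolding K_def using that by (simp add: module_hom_smult K_hom K_car)
  qed
  obtain C where C: "submodule C R M" "C \<inter> K = {\<zero>\<^bsub>M\<^esub>}"
    and max: "\<And>D. submodule D R M \<Longrightarrow> D \<inter> K = {\<zero>\<^bsub>M\<^esub>} \<Longrightarrow> C \<subseteq> D \<Longrightarrow> D = C"
    by (rule maximal_disjoint_submodule[OF K], rule that)
  note C_car = subsetD[OF submodule_subset[OF C(1)]]
  note K_car = subsetD[OF submodule_subset[OF K]]
  have zero_hom: "(\<lambda>_. \<zero>\<^bsub>M\<^esub>) \<in> module_hom R (submodule_of M C) M"
    by (rule module_homI) auto
  \<comment> \<open>The projection of K + C onto K along C, to be extended to all of M.\<close>
  obtain f where f: "f \<in> module_hom R (submodule_of M (K <+>\<^bsub>M\<^esub> C)) M"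
    and f_add: "\<And>k c. k \<in> K \<Longrightarrow> c \<in> C \<Longrightarrow> f (k \<oplus>\<^bsub>M\<^esub> c) = k \<oplus>\<^bsub>M\<^esub> \<zero>\<^bsub>M\<^esub>"
    by (rule disjoint_sum_hom[OF K C right_module_axioms
          module_hom_restrict[OF module_hom_id submodule_subset[OF K]] zero_hom], rule that)
  obtain g where g: "g \<in> module_hom R M M" and gf: "\<And>x. x \<in> K <+>\<^bsub>M\<^esub> C \<Longrightarrow> g x = f x"
    by (rule baer_extend[OF right_module_axioms baer right_module_axioms
        submodule_set_add[OF K C(1)] f], rule that)
  have g_add: "g (k \<oplus>\<^bsub>M\<^esub> c) = k" if "k \<in> K" "c \<in> C" for k c
    using gf[OF set_addI[OF that]] f_add[OF that] K_car[OF that(1)] by simp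
  have gk: "g k = k" if "k \<in> K" for k
    using g_add[OF that submodule_zero[OF C(1)]] K_car[OF that] by simp
  have "g e \<in> K" if e: "e \<in> carrier M" for e
  proof -
    \<comment> \<open>If e r = k + c, then h(g(e)) r = h(g(k + c)) = h(k) = 0, so h(g(e)) is
      annihilated by an essential right ideal.\<close>
    have "h (g e) = \<zero>" if h: "h \<in> module_hom R M (regular_module R)" for h
    proof (rule right_nonsingularD[OF ns essential_colon_ideal[OF K C max e]])
      fix r assume "r \<in> {r \<in> carrier R. r \<odot>\<^bsub>M\<^esub> e \<in> K <+>\<^bsub>M\<^esub> C}"
      then obtain k c where r: "r \<in> carrier R" and k: "k \<in> K" and c: "c \<in> C"
        and eq: "r \<odot>\<^bsub>M\<^esub> e = k \<oplus>\<^bsub>M\<^esub> c" by (auto elim: set_addE)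
      have "h (g e) \<otimes> r = h (g (r \<odot>\<^bsub>M\<^esub> e))"
        using module_hom_smult[OF module_hom_comp[OF g h] r e] by simp
      also have "\<dots> = \<zero>" using eq g_add[OF k c] k h by (simp add: K_def)
      finally show "h (g e) \<otimes> r = \<zero>" .
    next
      show "h (g e) \<in> carrier R"
        using module_hom_closed[OF h module_hom_closed[OF g e]] by simp
    qed
    then show ?thesis using module_hom_closed[OF g e] by (simp add: K_def)
  qed
  then have "g ` carrier M \<subseteq> K" by blast
  from that[OF K g this gk] show thesis .
qed

text \<open>This is the lifting property behind projectivity, for test modules of arbitrary carrier
  types. A maximal partial lift with Baer domain V must be total: an element outside V yields a map
  h vanishing on V, and the lift extends over V plus the summand cut out by h.\<close>

lemma torsionless_lifting:
  assumes noeth: "right_noetherian R" and ns: "right_nonsingular R" and baer: "baer R M"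
    and torsionless:
      "\<And>m. m \<in> carrier M \<Longrightarrow> m \<noteq> \<zero>\<^bsub>M\<^esub> \<Longrightarrow> \<exists>h\<in>module_hom R M (regular_module R). h m \<noteq> \<zero>"
    and B: "right_module R B" and C: "right_module R C"
    and g: "g \<in> module_hom R B C" "g ` carrier B = carrier C"
    and f: "f \<in> module_hom R M C"
  obtains l where "l \<in> module_hom R M B" "\<And>x. x \<in> carrier M \<Longrightarrow> g (l x) = f x"
proof -
  note M = right_module_axioms
  interpret B: right_module R B by (rule B)
  interpret C: right_module R C by (rule C)
  interpret P: right_module R "prod_module M B" by (rule right_module_prod[OF M B])
  note reg = right_module_regular'
  \<comment> \<open>Requiring a Baer domain makes each domain a direct summand of M, which the
    extension step needs. \<open>baer_chain_Union\<close> keeps this condition under unions of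
    chains.\<close>
  let ?P = "\<lambda>G. partial_hom R M B G \<and> baer R (submodule_of M (fst ` G)) \<and>
    (\<forall>x b. (x, b) \<in> G \<longrightarrow> g b = f x)"
  obtain G where PG: "?P G" and max: "\<And>H. ?P H \<Longrightarrow> G \<subseteq> H \<Longrightarrow> H = G"
  proof (rule Zorn_predicate[of ?P])
    show "?P {(\<zero>\<^bsub>M\<^esub>, \<zero>\<^bsub>B\<^esub>)}"
      using P.submodule_singleton_zero baer_zero[OF M] right_module_hom_zero[OF M C f]
        right_module_hom_zero[OF B C g(1)]
      by (simp add: partial_hom_def)
  next
    fix \<C> assume ne: "\<C> \<noteq> {}" and \<C>: "\<And>G. G \<in> \<C> \<Longrightarrow> ?P G"
      and ch: "\<And>G H. G \<in> \<C> \<Longrightarrow> H \<in> \<C> \<Longrightarrow> G \<subseteq> H \<or> H \<subseteq> G"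
    have ph: "partial_hom R M B G" if "G \<in> \<C>" for G using \<C>[OF that] by simp
    have "partial_hom R M B (\<Union>\<C>)"
      by (rule partial_hom_Union[OF M B ne ph ch])
    moreover have "baer R (submodule_of M (\<Union>((\<lambda>G. fst ` G) ` \<C>)))"
    proof (rule baer_chain_Union[OF M noeth])
      show "(\<lambda>G. fst ` G) ` \<C> \<noteq> {}" using ne by simp
      show "submodule V R M" if "V \<in> (\<lambda>G. fst ` G) ` \<C>" for V
        using that partial_hom_domain[OF M B ph] by auto
      show "baer R (submodule_of M V)" if "V \<in> (\<lambda>G. fst ` G) ` \<C>" for V
        using that \<C> by auto
      fix V W assume "V \<in> (\<lambda>G. fst ` G) ` \<C>" "W \<in> (\<lambda>G. fst ` G) ` \<C>"
      then obtain G H where GH: "G \<in> \<C>" "H \<in> \<C>" and "V = fst ` G" "W = fst ` H" by auto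
      then show "V \<subseteq> W \<or> W \<subseteq> V" using ch[OF GH] image_mono by metis
    qed
    moreover have "(\<Union>((\<lambda>G. fst ` G) ` \<C>)) = fst ` \<Union>\<C>" by (rule image_Union[symmetric])
    moreover have "g b = f x" if "(x, b) \<in> \<Union>\<C>" for x b using that \<C> by blast
    ultimately show "?P (\<Union>\<C>)" by simp
  qed metis
  then have G: "partial_hom R M B G" and baer_G: "baer R (submodule_of M (fst ` G))"
    and gG: "\<And>x b. (x, b) \<in> G \<Longrightarrow> g b = f x" by simp_all
  let ?V = "fst ` G"
  note V = partial_hom_domain[OF M B G]
  note V_car = subsetD[OF submodule_subset[OF V]]
  obtain l where l: "l \<in> module_hom R (submodule_of M ?V) B"
    and l_eq: "\<And>x y. (x, y) \<in> G \<Longrightarrow> l x = y" and l_mem: "\<And>x. x \<in> ?V \<Longrightarrow> (x, l x) \<in> G"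
    by (rule partial_hom_apply[OF M B G], rule that)
  have "m \<in> ?V" if m: "m \<in> carrier M" for m
  proof (rule ccontr)
    assume mV: "m \<notin> ?V"
    obtain p where p: "p \<in> module_hom R M M" and pV: "p ` carrier M \<subseteq> ?V"
      and p_id: "\<And>v. v \<in> ?V \<Longrightarrow> p v = v"
      by (rule baer_submodule_retraction[OF M V baer_G], rule that)
    have p_V: "p e \<in> ?V" if "e \<in> carrier M" for e using pV that by blast
    note p_closed = module_hom_closed[OF p]
    have "m \<ominus>\<^bsub>M\<^esub> p m \<noteq> \<zero>\<^bsub>M\<^esub>"
      using mV p_V[OF m] M.a_minus_eq_zero_iff[OF m p_closed[OF m]] by metis
    then obtain h0 where h0: "h0 \<in> module_hom R M (regular_module R)"
      and h0m: "h0 (m \<ominus>\<^bsub>M\<^esub> p m) \<noteq> \<zero>"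
      using torsionless[of "m \<ominus>\<^bsub>M\<^esub> p m"] m p_closed by auto
    \<comment> \<open>Composing with e - p(e) makes h vanish on V while h(m) stays nonzero, for m
      outside V.\<close>
    define h where "h e = h0 (e \<ominus>\<^bsub>M\<^esub> p e)" for e
    have h: "h \<in> module_hom R M (regular_module R)"
      unfolding h_def by (rule module_hom_comp[OF module_hom_diff[OF M module_hom_id p] h0])
    have h_closed: "h e \<in> carrier R" if "e \<in> carrier M" for e
      using module_hom_closed[OF h that] by simp
    have hV: "h v = \<zero>" if "v \<in> ?V" for v
      using p_id[OF that] V_car[OF that] right_module_hom_zero[OF M reg h0]
        M.a_minus_eq_zero_iff[of v v] by (simp add: h_def)
    obtain x where x: "x \<in> carrier M" and hx: "\<And>e. e \<in> carrier M \<Longrightarrow> h (h e \<odot>\<^bsub>M\<^esub> x) = h e"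
      by (rule hom_regular_idempotent[OF ns baer h], rule that)
    have "f x \<in> g ` carrier B" using module_hom_closed[OF f x] g(2) by simp
    \<comment> \<open>The assignment x h(e) \<mapsto> b h(e) will lift f on the summand of all x
      h(e).\<close>
    then obtain b where b: "b \<in> carrier B" "g b = f x" by auto
    define y where "y e = h e \<odot>\<^bsub>M\<^esub> x" for e
    have y: "y \<in> module_hom R M M"
      unfolding y_def by (rule module_hom_comp[OF h module_hom_orbit[OF x]])
    note y_closed = module_hom_closed[OF y]
    \<comment> \<open>Here y is the projection given by h, and w first removes the y-part and then
      projects to V. The sum w + y is a projection of M onto V + y(M): h vanishes on V and h(y(e)) =
      h(e), so the two parts do not interfere.\<close>
    define w where "w e = p (e \<ominus>\<^bsub>M\<^esub> y e)" for e
    have w: "w \<in> module_hom R M M"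
      unfolding w_def by (rule module_hom_comp[OF module_hom_diff[OF M module_hom_id y] p])
    have w_V: "w e \<in> ?V" if "e \<in> carrier M" for e
      unfolding w_def using that y_closed by (intro p_V) simp
    define p' where "p' e = w e \<oplus>\<^bsub>M\<^esub> y e" for e
    have p': "p' \<in> module_hom R M M"
      unfolding p'_def by (rule module_hom_plus[OF M w y])
    define L where "L e = l (w e) \<oplus>\<^bsub>B\<^esub> h e \<odot>\<^bsub>B\<^esub> b" for e
    have "w \<in> module_hom R M (submodule_of M ?V)"
      using w_V by (intro module_hom_into[OF w]) blast
    then have L: "L \<in> module_hom R M B"
      unfolding L_def
      by (intro module_hom_plus[OF B] module_hom_comp[OF _ l]
          module_hom_comp[OF h B.module_hom_orbit[OF b(1)]])
    have hp': "h (p' e) = h e" if e: "e \<in> carrier M" for e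
    proof -
      have "h (p' e) = h (w e) \<oplus> h (y e)"
        unfolding p'_def using module_hom_add[OF h V_car[OF w_V[OF e]] y_closed[OF e]] by simp
      then show ?thesis using hV[OF w_V[OF e]] hx[OF e] h_closed[OF e] by (simp add: y_def)
    qed
    have p'_V: "p' v = v" "L v = l v" if v: "v \<in> ?V" for v
    proof -
      have "y v = \<zero>\<^bsub>M\<^esub>" using hV[OF v] x by (simp add: y_def)
      moreover have "v \<ominus>\<^bsub>M\<^esub> \<zero>\<^bsub>M\<^esub> = v"
        using M.a_add_minus_cancel[of v "\<zero>\<^bsub>M\<^esub>"] V_car[OF v] by simp
      ultimately have "w v = v" using p_id[OF v] by (simp add: w_def)
      then show "p' v = v" "L v = l v"
        using \<open>y v = \<zero>\<^bsub>M\<^esub>\<close> V_car[OF v] hV[OF v] b(1) module_hom_closed[OF l, of v] v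
        by (simp_all add: p'_def L_def)
    qed
    have p'_idem: "p' (p' e) = p' e" if e: "e \<in> carrier M" for e
    proof -
      note we = V_car[OF w_V[OF e]]
      have yp': "y (p' e) = y e" using hp'[OF e] by (simp add: y_def)
      have "p' e \<ominus>\<^bsub>M\<^esub> y e = w e"
        unfolding p'_def using we y_closed[OF e] by (rule M.a_add_minus_cancel)
      then have "w (p' e) = p (w e)"
        using yp' by (simp add: w_def[of "p' e"])
      then have "p' (p' e) = w e \<oplus>\<^bsub>M\<^esub> y e"
        unfolding p'_def[of "p' e"] using yp' p_id[OF w_V[OF e]] by simp
      then show ?thesis by (simp only: p'_def[of e])
    qed
    \<comment> \<open>The enlarged lift sends w(e) + y(e) to the old lift of w(e) plus b h(e). It is
      well defined because \<open>p'\<close> preserves h: if p'(e) = 0, then h(e) = 0 and therefore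
      w(e) = 0.\<close>
    let ?G' = "(\<lambda>e. (p' e, L e)) ` carrier M"
    have G': "partial_hom R M B ?G'"
    proof (rule partial_hom_image_Pair[OF M M B p' L])
      fix e assume e: "e \<in> carrier M" and p'e: "p' e = \<zero>\<^bsub>M\<^esub>"
      have he: "h e = \<zero>"
        using hp'[OF e] p'e right_module_hom_zero[OF M reg h] by simp
      then have "w e = \<zero>\<^bsub>M\<^esub>"
        using p'e x V_car[OF w_V[OF e]] by (simp add: p'_def y_def)
      then show "L e = \<zero>\<^bsub>B\<^esub>"
        using he b(1) right_module_hom_zero[OF right_module_submodule[OF V] B l]
        by (simp add: L_def)
    qed
    have dom: "fst ` ?G' = p' ` carrier M" by (simp add: image_image)
    have "baer R (submodule_of M (fst ` ?G'))"
    proof (rule baer_retract[OF M baer partial_hom_domain[OF M B G'] p'])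
      show "p' ` carrier M \<subseteq> fst ` ?G'" using dom by simp
      show "p' v = v" if "v \<in> fst ` ?G'" for v using that p'_idem unfolding dom by auto
    qed
    moreover have "g b' = f v" if vb: "(v, b') \<in> ?G'" for v b'
    proof -
      obtain e where e: "e \<in> carrier M" and "v = p' e" "b' = L e" using vb by auto
      note we = w_V[OF e] V_car[OF w_V[OF e]]
      have "g (L e) = g (l (w e)) \<oplus>\<^bsub>C\<^esub> g (h e \<odot>\<^bsub>B\<^esub> b)"
        unfolding L_def using module_hom_closed[OF l, of "w e"] we b(1) h_closed[OF e]
        by (intro module_hom_add[OF g(1)]) simp_all
      also have "g (l (w e)) = f (w e)" using gG[OF l_mem[OF we(1)]] .
      also have "g (h e \<odot>\<^bsub>B\<^esub> b) = f (y e)"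
        unfolding y_def using module_hom_smult[OF g(1) h_closed[OF e] b(1)]
          module_hom_smult[OF f h_closed[OF e] x] b(2) by simp
      also have "f (w e) \<oplus>\<^bsub>C\<^esub> f (y e) = f (p' e)"
        unfolding p'_def using module_hom_add[OF f we(2) y_closed[OF e]] by simp
      finally show ?thesis using \<open>v = p' e\<close> \<open>b' = L e\<close> by simp
    qed
    ultimately have "?P ?G'" using G' by simp
    moreover have "G \<subseteq> ?G'"
    proof
      fix z assume z: "z \<in> G"
      then have "fst z \<in> ?V" "l (fst z) = snd z" using l_eq[of "fst z" "snd z"] by auto
      then have "z = (p' (fst z), L (fst z))" using p'_V by (simp add: prod_eq_iff)
      then show "z \<in> ?G'" using V_car[OF \<open>fst z \<in> ?V\<close>] by (rule image_eqI)
    qed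
    \<comment> \<open>Maximality puts p'(m) into V, where h vanishes, but h(p'(m)) = h(m) is
      nonzero.\<close>
    ultimately have "?G' = G" by (rule max)
    then have "p' ` carrier M = ?V" using dom by simp
    then have "p' m \<in> ?V" using m by blast
    then show False using hV[of "p' m"] hp'[OF m] h0m by (simp add: h_def)
  qed
  then have V_eq: "?V = carrier M" using V_car by blast
  with l have "l \<in> module_hom R M B" by (simp add: module_hom_def)
  moreover have "g (l x) = f x" if "x \<in> carrier M" for x
    using that V_eq by (intro gG[OF l_mem]) simp
  ultimately show thesis by (rule that)
qed

end

section \<open>Changing the carrier type\<close>

text \<open>Isomorphic copy of M along an injection of its carrier. It moves R and its quotients
  into the fixed carrier type of the test modules for injectivity and projectivity.\<close>

definition transport_module ::
    "('b \<Rightarrow> 'c) \<Rightarrow> ('a, 'b, 's) module_scheme \<Rightarrow> ('a, 'c) module"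
  where "transport_module \<phi> M =
    (let \<psi> = inv_into (carrier M) \<phi> in
      \<lparr>carrier = \<phi> ` carrier M, mult = undefined, one = undefined, zero = \<phi> \<zero>\<^bsub>M\<^esub>,
       add = (\<lambda>x y. \<phi> (\<psi> x \<oplus>\<^bsub>M\<^esub> \<psi> y)), smult = (\<lambda>r x. \<phi> (r \<odot>\<^bsub>M\<^esub> \<psi> x))\<rparr>)"

lemma transport_module_simps:
  assumes "inj_on \<phi> (carrier M)"
  shows "carrier (transport_module \<phi> M) = \<phi> ` carrier M"
    and "\<zero>\<^bsub>transport_module \<phi> M\<^esub> = \<phi> \<zero>\<^bsub>M\<^esub>"
    and "x \<in> carrier M \<Longrightarrow> y \<in> carrier M \<Longrightarrow> \<phi> x \<oplus>\<^bsub>transport_module \<phi> M\<^esub> \<phi> y = \<phi> (x \<oplus>\<^bsub>M\<^esub> y)"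
    and "x \<in> carrier M \<Longrightarrow> r \<odot>\<^bsub>transport_module \<phi> M\<^esub> \<phi> x = \<phi> (r \<odot>\<^bsub>M\<^esub> x)"
  using assms by (simp_all add: transport_module_def Let_def)

lemma right_module_transport:
  assumes "right_module R M" and inj: "inj_on \<phi> (carrier M)"
  shows "right_module R (transport_module \<phi> M)"
proof -
  interpret M: right_module R M by fact
  note [simp] = transport_module_simps[OF inj]
  have "abelian_group (transport_module \<phi> M)"
  proof (rule abelian_groupI)
    fix X assume "X \<in> carrier (transport_module \<phi> M)"
    then obtain x where "x \<in> carrier M" "X = \<phi> x" by auto
    then show "\<exists>Y\<in>carrier (transport_module \<phi> M).
        Y \<oplus>\<^bsub>transport_module \<phi> M\<^esub> X = \<zero>\<^bsub>transport_module \<phi> M\<^esub>"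
      by (intro bexI[of _ "\<phi> (\<ominus>\<^bsub>M\<^esub> x)"]) (simp_all add: M.M.l_neg)
  qed (auto simp: M.M.a_ac)
  then show ?thesis
    by (intro right_module.intro right_module_axioms.intro)
      (auto simp: M.R.ring_axioms M.smult_l_distr M.smult_r_distr M.smult_assoc)
qed

lemma module_hom_transport:
  "inj_on \<phi> (carrier M) \<Longrightarrow> \<phi> \<in> module_hom R M (transport_module \<phi> M)"
  by (rule module_homI) (simp_all add: transport_module_simps)

lemma module_hom_transport_inv:
  assumes "right_module R M" "inj_on \<phi> (carrier M)"
  shows "inv_into (carrier M) \<phi> \<in> module_hom R (transport_module \<phi> M) M"
proof -
  interpret M: right_module R M by fact
  show ?thesis
    by (rule module_homI) (auto simp: transport_module_simps[OF assms(2)] assms(2))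
qed

lemma inj_const_singleton: "inj_on (\<lambda>a. {\<lambda>_. a}) A"
  by (rule inj_onI) (metis singleton_inject)

text \<open>Embeds sets of ring elements, and so the cosets forming R/I, into the type of test
  modules.\<close>

lemma inj_image_const: "inj_on (\<lambda>X. (\<lambda>a _. a) ` X) A"
proof (rule inj_onI)
  fix X Y :: "'a set" assume "(\<lambda>a (_ :: 'b). a) ` X = (\<lambda>a _. a) ` Y"
  moreover have "inj (\<lambda>a (_ :: 'b). a :: 'a)" by (rule injI) metis
  ultimately show "X = Y" by (simp add: inj_image_eq_iff)
qed

text \<open>R and the right ideal J are copied into the test type by constant functions. An
  extension of f to the copy of R is determined by its value at the copy of 1, which is the required
  element.\<close>

lemma injective_module_imp_baer:
  fixes E :: "('a, 'm) module"
  assumes inj: "injective_module R E"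
  shows "baer R E"
  unfolding baer_def
proof (intro allI impI ballI)
  have E: "right_module R E" using inj by (simp add: injective_module_def)
  interpret E: right_module R E by (rule E)
  note reg = E.right_module_regular'
  define \<phi> :: "'a \<Rightarrow> ('m \<Rightarrow> 'a) set" where "\<phi> a = {\<lambda>_. a}" for a
  let ?T = "transport_module \<phi> (regular_module R)"
  let ?\<psi> = "inv_into (carrier (regular_module R)) \<phi>"
  have \<phi>: "inj_on \<phi> (carrier (regular_module R))"
    unfolding \<phi>_def by (rule inj_const_singleton)
  have T: "right_module R ?T" by (rule right_module_transport[OF reg \<phi>])
  fix J f assume "right_ideal R J"
    and f: "f \<in> module_hom R (submodule_of (regular_module R) J) E"
  then have J: "submodule J R (regular_module R)" by (simp add: right_ideal_def)
  note J_car = subsetD[OF submodule_subset[OF J]]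
  let ?A = "submodule_of ?T (\<phi> ` J)"
  have sub: "submodule (\<phi> ` J) R ?T"
    by (rule submodule_image[OF reg T module_hom_transport[OF \<phi>] J])
  have \<psi>\<phi>: "?\<psi> (\<phi> r) = r" if "r \<in> carrier R" for r
    using that \<phi> by (simp add: inv_into_f_f)
  have "?\<psi> \<in> module_hom R ?A (submodule_of (regular_module R) J)"
    using J_car \<psi>\<phi>
    by (intro module_hom_into[OF module_hom_restrict[OF module_hom_transport_inv[OF reg \<phi>]
            submodule_subset[OF sub]]]) auto
  note f' = module_hom_comp[OF this f]
  have "(\<lambda>x. x) \<in> module_hom R ?A ?T"
    by (rule module_hom_restrict[OF module_hom_id submodule_subset[OF sub]])
  moreover have "inj_on (\<lambda>x. x) (carrier ?A)" by (rule inj_on_id2)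
  ultimately have "\<exists>h\<in>module_hom R ?T E. \<forall>x\<in>carrier ?A. h x = f (?\<psi> x)"
    using inj f' T right_module.right_module_submodule[OF T sub]
    unfolding injective_module_def by blast
  then obtain h where h: "h \<in> module_hom R ?T E" and hf: "\<And>x. x \<in> carrier ?A \<Longrightarrow> h x = f (?\<psi> x)"
    by auto
  note h\<phi> = module_hom_comp[OF module_hom_transport[OF \<phi>] h]
  have "f r = r \<odot>\<^bsub>E\<^esub> h (\<phi> \<one>\<^bsub>R\<^esub>)" if r: "r \<in> J" for r
  proof -
    have r': "r \<in> carrier R" using J_car[OF r] by simp
    have "f r = h (\<phi> r)" using hf[of "\<phi> r"] \<psi>\<phi>[OF r'] r by simp
    also have "\<dots> = h (\<phi> (r \<odot>\<^bsub>regular_module R\<^esub> \<one>\<^bsub>R\<^esub>))" using r' by simp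
    also have "\<dots> = r \<odot>\<^bsub>E\<^esub> h (\<phi> \<one>\<^bsub>R\<^esub>)" by (rule module_hom_smult[OF h\<phi> r']) simp
    finally show ?thesis .
  qed
  moreover have "h (\<phi> \<one>\<^bsub>R\<^esub>) \<in> carrier E" by (rule module_hom_closed[OF h\<phi>]) simp
  ultimately show "\<exists>x\<in>carrier E. \<forall>r\<in>J. f r = r \<odot>\<^bsub>E\<^esub> x" by blast
qed

text \<open>The map i(x) \<mapsto> f(x) on the image of i reduces an arbitrary monomorphism to the
  inclusion of a submodule.\<close>

lemma baer_extend_inj:
  assumes E: "right_module R E" "baer R E" and A: "right_module R A" and B: "right_module R B"
    and i: "i \<in> module_hom R A B" "inj_on i (carrier A)" and f: "f \<in> module_hom R A E"
  obtains h where "h \<in> module_hom R B E" "\<And>x. x \<in> carrier A \<Longrightarrow> h (i x) = f x"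
proof -
  interpret A: right_module R A by (rule A)
  let ?G = "(\<lambda>x. (i x, f x)) ` carrier A"
  have G: "partial_hom R B E ?G"
  proof (rule partial_hom_image_Pair[OF A B E(1) i(1) f])
    fix x assume "x \<in> carrier A" "i x = \<zero>\<^bsub>B\<^esub>"
    then have "x = \<zero>\<^bsub>A\<^esub>"
      using right_module_hom_zero[OF A B i(1)] inj_onD[OF i(2), of x "\<zero>\<^bsub>A\<^esub>"] by simp
    then show "f x = \<zero>\<^bsub>E\<^esub>" using right_module_hom_zero[OF A E(1) f] by simp
  qed
  obtain f' where f': "f' \<in> module_hom R (submodule_of B (fst ` ?G)) E"
    and f'_eq: "\<And>x y. (x, y) \<in> ?G \<Longrightarrow> f' x = y"
    and "\<And>x. x \<in> fst ` ?G \<Longrightarrow> (x, f' x) \<in> ?G"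
    by (rule partial_hom_apply[OF B E(1) G], rule that)
  obtain h where h: "h \<in> module_hom R B E" and hf': "\<And>x. x \<in> fst ` ?G \<Longrightarrow> h x = f' x"
    by (rule baer_extend[OF E B partial_hom_domain[OF B E(1) G] f'], rule that)
  have "h (i x) = f x" if x: "x \<in> carrier A" for x
  proof -
    have "(i x, f x) \<in> ?G" using x by (rule imageI)
    from hf'[OF image_eqI[OF _ this]] f'_eq[OF this] show ?thesis by simp
  qed
  with h show thesis by (rule that)
qed

lemma baer_imp_injective_module:
  assumes "right_module R E" "baer R E"
  shows "injective_module R E"
  unfolding injective_module_def
  using assms baer_extend_inj[OF assms] by metis

text \<open>Frees the lifting property from the test type: the problem is copied along \<beta> and
  \<gamma>, solved there, and brought back by inverting \<beta> and cancelling the injective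
  \<gamma>.\<close>

lemma projective_module_lifting:
  fixes P :: "('a, 'm) module" and \<beta> :: "'b \<Rightarrow> ('m \<Rightarrow> 'a) set" and \<gamma> :: "'c \<Rightarrow> ('m \<Rightarrow> 'a) set"
  assumes P: "projective_module R P"
    and B: "right_module R B" "inj_on \<beta> (carrier B)"
    and C: "right_module R C" "inj_on \<gamma> (carrier C)"
    and g: "g \<in> module_hom R B C" "g ` carrier B = carrier C" and f: "f \<in> module_hom R P C"
  obtains l where "l \<in> module_hom R P B" "\<And>x. x \<in> carrier P \<Longrightarrow> g (l x) = f x"
proof -
  let ?B = "transport_module \<beta> B" and ?C = "transport_module \<gamma> C"
  let ?\<beta>' = "inv_into (carrier B) \<beta>"
  let ?g = "\<lambda>x. \<gamma> (g (?\<beta>' x))"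
  have \<beta>': "?\<beta>' \<in> module_hom R ?B B" by (rule module_hom_transport_inv[OF B])
  note \<gamma> = module_hom_transport[OF C(2)]
  have "?g \<in> module_hom R ?B ?C"
    by (rule module_hom_comp[OF module_hom_comp[OF \<beta>' g(1)] \<gamma>])
  moreover have "?g ` carrier ?B = carrier ?C"
  proof -
    have "?\<beta>' ` carrier ?B = carrier B"
      using B(2) by (simp add: transport_module_simps(1)[OF B(2)])
    moreover have "?g ` carrier ?B = \<gamma> ` g ` ?\<beta>' ` carrier ?B" by (simp only: image_image)
    ultimately show ?thesis using g(2) transport_module_simps(1)[OF C(2)] by metis
  qed
  ultimately have "\<exists>h\<in>module_hom R P ?B. \<forall>x\<in>carrier P. ?g (h x) = \<gamma> (f x)"
    using P module_hom_comp[OF f \<gamma>] right_module_transport[OF B] right_module_transport[OF C]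
    unfolding projective_module_def by blast
  then obtain h where h: "h \<in> module_hom R P ?B" and gh: "\<And>x. x \<in> carrier P \<Longrightarrow> ?g (h x) = \<gamma> (f x)"
    by auto
  note l = module_hom_comp[OF h \<beta>']
  have "g (?\<beta>' (h x)) = f x" if x: "x \<in> carrier P" for x
    by (rule inj_onD[OF C(2) gh[OF x] module_hom_closed[OF g(1) module_hom_closed[OF l x]]
          module_hom_closed[OF f x]])
  with l show thesis by (rule that)
qed

section \<open>Quotients and maximal submodules\<close>

context right_module
begin

lemma coset_eq_iff:
  assumes N: "submodule N R M" and "x \<in> carrier M" "y \<in> carrier M"
  shows "N +>\<^bsub>M\<^esub> x = N +>\<^bsub>M\<^esub> y \<longleftrightarrow> x \<ominus>\<^bsub>M\<^esub> y \<in> N"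
proof
  note N_car = subsetD[OF submodule_subset[OF N]]
  have "x = \<zero>\<^bsub>M\<^esub> \<oplus>\<^bsub>M\<^esub> x" using assms by simp
  then have "x \<in> N +>\<^bsub>M\<^esub> x" using submodule_zero[OF N] unfolding a_r_coset_def' by blast
  moreover assume "N +>\<^bsub>M\<^esub> x = N +>\<^bsub>M\<^esub> y"
  ultimately obtain n where n: "n \<in> N" "x = n \<oplus>\<^bsub>M\<^esub> y" by (auto simp: a_r_coset_def')
  then show "x \<ominus>\<^bsub>M\<^esub> y \<in> N" using assms N_car by (simp add: M.a_add_minus_cancel)
next
  assume "x \<ominus>\<^bsub>M\<^esub> y \<in> N"
  moreover have "x = (x \<ominus>\<^bsub>M\<^esub> y) \<oplus>\<^bsub>M\<^esub> y" using assms by (simp add: M.a_minus_add_cancel)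
  ultimately have "x \<in> N +>\<^bsub>M\<^esub> y" unfolding a_r_coset_def' by blast
  moreover have "subgroup N (add_monoid M)"
    using N by (simp add: submodule_def)
  ultimately show "N +>\<^bsub>M\<^esub> x = N +>\<^bsub>M\<^esub> y"
    using M.a_repr_independence assms by metis
qed

lemma coset_mem:
  assumes N: "submodule N R M" and "x \<in> N"
  shows "N +>\<^bsub>M\<^esub> x = \<zero>\<^bsub>quotient_module M N\<^esub>"
proof -
  have sub: "N \<subseteq> carrier M" by (rule submodule_subset[OF N])
  then have "N +>\<^bsub>M\<^esub> x = N +>\<^bsub>M\<^esub> \<zero>\<^bsub>M\<^esub>"
    using assms submodule_minus[OF N _ submodule_zero[OF N]]
    by (subst coset_eq_iff[OF N]) auto
  then show ?thesis using M.a_coset_add_zero[OF sub] by (simp add: quotient_module_def)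
qed

lemma module_hom_coset:
  assumes N: "submodule N R M"
  shows "(\<lambda>x. N +>\<^bsub>M\<^esub> x) \<in> module_hom R M (quotient_module M N)"
    and "(\<lambda>x. N +>\<^bsub>M\<^esub> x) ` carrier M = carrier (quotient_module M N)"
proof -
  interpret A: abelian_subgroup N M
    using N by (intro abelian_subgroupI3 additive_subgroup.intro)
      (auto simp: submodule_def M.abelian_group_axioms)
  show surj: "(\<lambda>x. N +>\<^bsub>M\<^esub> x) ` carrier M = carrier (quotient_module M N)"
    by (auto simp: quotient_module_def A_RCOSETS_def')
  show "(\<lambda>x. N +>\<^bsub>M\<^esub> x) \<in> module_hom R M (quotient_module M N)"
  proof (rule module_homI)
    show "N +>\<^bsub>M\<^esub> x \<in> carrier (quotient_module M N)" if "x \<in> carrier M" for x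
      using surj that by blast
    show "N +>\<^bsub>M\<^esub> (x \<oplus>\<^bsub>M\<^esub> y) = (N +>\<^bsub>M\<^esub> x) \<oplus>\<^bsub>quotient_module M N\<^esub> (N +>\<^bsub>M\<^esub> y)"
      if "x \<in> carrier M" "y \<in> carrier M" for x y
      using A.a_rcos_sum[OF that] by (simp add: quotient_module_def)
  qed (simp add: quotient_smult[OF N])
qed

end

section \<open>Lifting modulo right ideals and the radical\<close>

lemma regular_coset: "I +>\<^bsub>regular_module R\<^esub> x = I +>\<^bsub>R\<^esub> x"
  by (simp add: a_r_coset_def')

lemma lifts_moduloD:
  assumes "lifts_modulo R M I" "f \<in> module_hom R M (quotient_module (regular_module R) I)"
  obtains h where "h \<in> module_hom R M (regular_module R)"
    "\<And>x. x \<in> carrier M \<Longrightarrow> f x = I +>\<^bsub>R\<^esub> h x"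
  using assms unfolding lifts_modulo_def by metis

text \<open>For x outside N, the simple module M/N is isomorphic to R/I, where I consists of all r
  with x r in N. A lift h of M \<rightarrow> R/I satisfies h(x) = 1 modulo the proper ideal I, hence
  h(x) is nonzero.\<close>

lemma max_projective_imp_hom:
  assumes M: "right_module R M" and max: "max_projective R M" and N: "maximal_submodule R M N"
  obtains h x where "h \<in> module_hom R M (regular_module R)" "x \<in> carrier M" "h x \<noteq> \<zero>\<^bsub>R\<^esub>"
proof -
  interpret M: right_module R M by (rule M)
  note reg = M.right_module_regular'
  interpret Reg: right_module R "regular_module R" by (rule reg)
  have N_sub: "submodule N R M" and "N \<noteq> carrier M"
    and N_max: "\<And>K. submodule K R M \<Longrightarrow> N \<subseteq> K \<Longrightarrow> K = N \<or> K = carrier M"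
    using N unfolding maximal_submodule_def by blast+
  then obtain x where x: "x \<in> carrier M" "x \<notin> N" using submodule_subset[OF N_sub] by blast
  note N_car = subsetD[OF submodule_subset[OF N_sub]]
  let ?I = "{r \<in> carrier (regular_module R). r \<odot>\<^bsub>M\<^esub> x \<in> N}"
  have I: "submodule ?I R (regular_module R)"
    by (rule submodule_vimage[OF reg M M.module_hom_orbit[OF x(1)] N_sub])
  have adjoin: "M.adjoin N (r \<odot>\<^bsub>M\<^esub> x) = carrier M" if "r \<in> carrier R" "r \<odot>\<^bsub>M\<^esub> x \<notin> N" for r
    using N_max[OF M.submodule_adjoin(1,2)[OF N_sub]] M.submodule_adjoin(3)[OF N_sub] that x
    by (metis M.smult_closed)
  \<comment> \<open>If K contains I and some r outside I, then N + (x r)R = M gives x = n + x r s.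
    So 1 - r s lies in I, and both 1 - r s and r s lie in K, which puts 1 into K.\<close>
  have "maximal_right_ideal R ?I"
    unfolding maximal_right_ideal_def maximal_submodule_def
  proof (intro conjI allI impI)
    show "?I \<noteq> carrier (regular_module R)" using x by force
    fix K assume "submodule K R (regular_module R) \<and> ?I \<subseteq> K"
    then have K: "submodule K R (regular_module R)" and IK: "?I \<subseteq> K" by auto
    have "K = carrier R" if ne: "K \<noteq> ?I"
    proof -
      have "\<not> K \<subseteq> ?I" using IK ne by (metis subset_antisym)
      then obtain r where r: "r \<in> K" "r \<notin> ?I" by (meson subsetI)
      then have r': "r \<in> carrier R" "r \<odot>\<^bsub>M\<^esub> x \<notin> N" using submodule_subset[OF K] by auto
      obtain n s where n: "n \<in> N" and s: "s \<in> carrier R"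
        and xn: "x = n \<oplus>\<^bsub>M\<^esub> s \<odot>\<^bsub>M\<^esub> (r \<odot>\<^bsub>M\<^esub> x)"
        using adjoin[OF r'] x(1) M.adjoinE by metis
      have rs: "r \<otimes>\<^bsub>R\<^esub> s \<in> K" using submodule_smult[OF K s r(1)] by simp
      have "(\<one>\<^bsub>R\<^esub> \<ominus>\<^bsub>R\<^esub> r \<otimes>\<^bsub>R\<^esub> s) \<odot>\<^bsub>M\<^esub> x = x \<ominus>\<^bsub>M\<^esub> s \<odot>\<^bsub>M\<^esub> (r \<odot>\<^bsub>M\<^esub> x)"
        using r' s x by (simp add: M.smult_l_minus M.smult_assoc)
      also have "\<dots> = n"
        using xn n N_car r' s x by (subst eq_commute) (subst M.M.eq_a_minus_iff, auto)
      finally have "\<one>\<^bsub>R\<^esub> \<ominus>\<^bsub>R\<^esub> r \<otimes>\<^bsub>R\<^esub> s \<in> ?I" using n r' s by simp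
      then have "\<one>\<^bsub>R\<^esub> \<ominus>\<^bsub>R\<^esub> r \<otimes>\<^bsub>R\<^esub> s \<in> K" using IK by blast
      from submodule_add[OF K this rs] have one: "\<one>\<^bsub>R\<^esub> \<in> K"
        using r' s by (simp add: M.R.a_minus_add_cancel)
      have "t \<in> K" if "t \<in> carrier R" for t
        using submodule_smult[OF K that one] that by simp
      then show ?thesis using submodule_subset[OF K] by auto
    qed
    then show "K = ?I \<or> K = carrier (regular_module R)" by auto
  qed (rule I)
  \<comment> \<open>The composite M \<rightarrow> M/N \<rightarrow> R/I is constructed directly as n
    + x r \<mapsto> I + r. It is total because N + xR = M.\<close>
  let ?L = "prod_module (submodule_of M N) (regular_module R)"
  let ?Q = "quotient_module (regular_module R) ?I"
  let ?sum = "\<lambda>p. fst p \<oplus>\<^bsub>M\<^esub> snd p \<odot>\<^bsub>M\<^esub> x" and ?val = "\<lambda>p. ?I +>\<^bsub>regular_module R\<^esub> snd p"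
  have L: "right_module R ?L"
    by (rule right_module_prod[OF M.right_module_submodule[OF N_sub] reg])
  have Q: "right_module R ?Q" by (rule Reg.right_module_quotient[OF I])
  have sum: "?sum \<in> module_hom R ?L M"
    by (rule module_hom_plus[OF M module_hom_from[OF module_hom_fst submodule_subset[OF N_sub]]
          module_hom_comp[OF module_hom_snd M.module_hom_orbit[OF x(1)]]])
  have val: "?val \<in> module_hom R ?L ?Q"
    by (rule module_hom_comp[OF module_hom_snd Reg.module_hom_coset(1)[OF I]])
  let ?G = "(\<lambda>p. (?sum p, ?val p)) ` carrier ?L"
  have G: "partial_hom R M ?Q ?G"
  proof (rule partial_hom_image_Pair[OF L M Q sum val])
    fix p assume "p \<in> carrier ?L" and sum0: "fst p \<oplus>\<^bsub>M\<^esub> snd p \<odot>\<^bsub>M\<^esub> x = \<zero>\<^bsub>M\<^esub>"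
    then have p: "fst p \<in> N" "snd p \<in> carrier R" by auto
    have "snd p \<odot>\<^bsub>M\<^esub> x = \<ominus>\<^bsub>M\<^esub> fst p"
      using sum0 p N_car x by (intro M.M.minus_equality[symmetric]) (auto simp: M.M.a_comm)
    then have "snd p \<in> ?I" using p submodule_neg[OF N_sub p(1)] by simp
    then show "?val p = \<zero>\<^bsub>?Q\<^esub>" by (rule Reg.coset_mem[OF I])
  qed
  have one_x: "\<one>\<^bsub>R\<^esub> \<odot>\<^bsub>M\<^esub> x \<notin> N" using x by simp
  have dom: "fst ` ?G = carrier M"
  proof -
    have "fst ` ?G = M.adjoin N (\<one>\<^bsub>R\<^esub> \<odot>\<^bsub>M\<^esub> x)"
      using x(1) by (force simp: M.adjoin_def image_iff)
    then show ?thesis using adjoin[OF M.R.one_closed one_x] by simp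
  qed
  obtain f where f: "f \<in> module_hom R (submodule_of M (fst ` ?G)) ?Q"
    and f_eq: "\<And>x y. (x, y) \<in> ?G \<Longrightarrow> f x = y"
    and "\<And>x. x \<in> fst ` ?G \<Longrightarrow> (x, f x) \<in> ?G"
    by (rule partial_hom_apply[OF M Q G], rule that)
  have f': "f \<in> module_hom R M ?Q" using f unfolding dom by (simp add: module_hom_def)
  have lifts: "lifts_modulo R M ?I"
    using max \<open>maximal_right_ideal R ?I\<close> unfolding max_projective_def by metis
  obtain h where h: "h \<in> module_hom R M (regular_module R)"
    and fh: "\<And>y. y \<in> carrier M \<Longrightarrow> f y = ?I +>\<^bsub>R\<^esub> h y"
    by (rule lifts_moduloD[OF lifts f'], rule that)
  have "f x = ?I +>\<^bsub>regular_module R\<^esub> \<one>\<^bsub>R\<^esub>"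
    by (rule f_eq, rule image_eqI[of _ _ "(\<zero>\<^bsub>M\<^esub>, \<one>\<^bsub>R\<^esub>)"])
      (use x submodule_zero[OF N_sub] in auto)
  then have "?I +>\<^bsub>regular_module R\<^esub> h x = ?I +>\<^bsub>regular_module R\<^esub> \<one>\<^bsub>R\<^esub>"
    using fh[OF x(1)] by (simp add: regular_coset)
  then have "h x \<ominus>\<^bsub>R\<^esub> \<one>\<^bsub>R\<^esub> \<in> ?I"
    using Reg.coset_eq_iff[OF I] module_hom_closed[OF h x(1)] by simp
  \<comment> \<open>If h(x) were zero, then -1 would lie in I and x in N.\<close>
  then have "h x \<noteq> \<zero>\<^bsub>R\<^esub>"
    using x by (auto simp: M.smult_l_minus a_minus_def M.R.minus_closed M.neg_smult
        dest: submodule_neg[OF N_sub])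
  with h x(1) show thesis by (rule that)
qed

text \<open>A nonzero image f(M) has the form D/I with D properly containing I. By the Noetherian
  condition there is L maximal among the right ideals between I and D other than D. The preimage of
  L/I is then a maximal submodule of M, which Rad M = M excludes.\<close>

lemma radical_hom_cyclic_zero:
  assumes noeth: "right_noetherian R" and M: "right_module R M"
    and rad: "module_Rad R M = carrier M"
    and I: "right_ideal R I" and f: "f \<in> module_hom R M (quotient_module (regular_module R) I)"
    and x: "x \<in> carrier M"
  shows "f x = \<zero>\<^bsub>quotient_module (regular_module R) I\<^esub>"
proof (rule ccontr)
  interpret M: right_module R M by (rule M)
  note reg = M.right_module_regular'
  interpret Reg: right_module R "regular_module R" by (rule reg)
  let ?Q = "quotient_module (regular_module R) I"
  let ?\<pi> = "\<lambda>r. I +>\<^bsub>regular_module R\<^esub> r"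
  assume fx: "f x \<noteq> \<zero>\<^bsub>?Q\<^esub>"
  have I': "submodule I R (regular_module R)" using I by (simp add: right_ideal_def)
  have Q: "right_module R ?Q" by (rule Reg.right_module_quotient[OF I'])
  interpret Q: right_module R ?Q by (rule Q)
  have \<pi>: "?\<pi> \<in> module_hom R (regular_module R) ?Q" and surj: "?\<pi> ` carrier R = carrier ?Q"
    using Reg.module_hom_coset[OF I'] by simp_all
  have rep: "\<exists>r\<in>carrier R. f y = ?\<pi> r" if "y \<in> carrier M" for y
    using module_hom_closed[OF f that] surj by (metis imageE)
  \<comment> \<open>The right ideal of R that corresponds to f(K) in R/I.\<close>
  define pre where "pre K = {r \<in> carrier (regular_module R). ?\<pi> r \<in> f ` K}" for K
  have pre: "right_ideal R (pre K)" if "submodule K R M" for K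
    unfolding pre_def right_ideal_def
    by (rule submodule_vimage[OF reg Q \<pi> submodule_image[OF M Q f that]])
  have preI: "r \<in> pre K" if "k \<in> K" "r \<in> carrier R" "f k = ?\<pi> r" for r k K
    using that unfolding pre_def by (metis (mono_tags, lifting) imageI mem_Collect_eq regular_module_simps(1))
  have preE: "\<exists>k\<in>K. f k = ?\<pi> r" if "r \<in> pre K" for r K
    using that unfolding pre_def by auto
  let ?D = "pre (carrier M)"
  have pre_mono: "pre K \<subseteq> ?D" if "submodule K R M" for K
    using submodule_subset[OF that] unfolding pre_def by blast
  have I_pre: "I \<subseteq> pre K" if K: "submodule K R M" for K
  proof
    fix r assume r: "r \<in> I"
    then have "?\<pi> r = \<zero>\<^bsub>?Q\<^esub>" by (rule Reg.coset_mem[OF I'])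
    moreover have "f \<zero>\<^bsub>M\<^esub> = \<zero>\<^bsub>?Q\<^esub>" by (rule right_module_hom_zero[OF M Q f])
    moreover have "r \<in> carrier R" using submodule_subset[OF I'] r by auto
    ultimately show "r \<in> pre K" using preI[OF submodule_zero[OF K]] by simp
  qed
  obtain r where r: "r \<in> carrier R" "f x = ?\<pi> r" using rep[OF x] by metis
  have "r \<in> ?D" using preI[OF x r] .
  moreover have "r \<notin> I" using Reg.coset_mem[OF I'] r fx by metis
  ultimately have "I \<noteq> ?D" by metis
  let ?\<J> = "{L. right_ideal R L \<and> I \<subseteq> L \<and> L \<subseteq> ?D \<and> L \<noteq> ?D}"
  have "I \<in> ?\<J>" using I I_pre[OF M.submodule_carrier] \<open>I \<noteq> ?D\<close> by simp
  then have ne: "?\<J> \<noteq> {}" by (metis empty_iff)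
  obtain L where "L \<in> ?\<J>" and L_max: "\<And>K. K \<in> ?\<J> \<Longrightarrow> L \<subseteq> K \<Longrightarrow> K = L"
    by (rule noetherian_maximal[OF noeth ne], simp, rule that)
  then have L: "submodule L R (regular_module R)" and "I \<subseteq> L" and LD: "L \<subseteq> ?D" and "L \<noteq> ?D"
    by (simp_all add: right_ideal_def)
  have L_car: "s \<in> carrier R" if "s \<in> L" for s using submodule_subset[OF L] that by auto
  let ?N = "{y \<in> carrier M. f y \<in> ?\<pi> ` L}"
  have N: "submodule ?N R M"
    by (rule submodule_vimage[OF M Q f submodule_image[OF reg Q \<pi> L]])
  \<comment> \<open>Since L contains I, membership in L can be read off from cosets.\<close>
  have L_iff: "s \<in> L" if "?\<pi> s \<in> ?\<pi> ` L" "s \<in> carrier R" for s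
  proof -
    obtain t where t: "t \<in> L" "?\<pi> s = ?\<pi> t" using \<open>?\<pi> s \<in> ?\<pi> ` L\<close> by (rule imageE)
    then have "s \<ominus>\<^bsub>R\<^esub> t \<in> I"
      using Reg.coset_eq_iff[OF I', of s t] \<open>s \<in> carrier R\<close> L_car by simp
    then have "s \<ominus>\<^bsub>R\<^esub> t \<in> L" using \<open>I \<subseteq> L\<close> by blast
    from submodule_add[OF L this t(1)] show "s \<in> L"
      using \<open>s \<in> carrier R\<close> L_car[OF t(1)] by (simp add: M.R.a_minus_add_cancel)
  qed
  have "maximal_submodule R M ?N"
    unfolding maximal_submodule_def
  proof (intro conjI allI impI)
    show "?N \<noteq> carrier M"
    proof
      assume N_eq: "?N = carrier M"
      have "s \<in> L" if s: "s \<in> ?D" for s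
      proof -
        obtain y where "y \<in> carrier M" "f y = ?\<pi> s" using preE[OF s] by metis
        moreover have "s \<in> carrier R" using s by (simp add: pre_def)
        ultimately show "s \<in> L" using N_eq L_iff by (metis (mono_tags, lifting) mem_Collect_eq)
      qed
      then show False using LD \<open>L \<noteq> ?D\<close> by (metis subsetI subset_antisym)
    qed
  next
    fix K assume "submodule K R M \<and> ?N \<subseteq> K"
    then have K: "submodule K R M" and NK: "?N \<subseteq> K" by simp_all
    note K_car = subsetD[OF submodule_subset[OF K]]
    have "K = carrier M" if ne: "K \<noteq> ?N"
    proof -
      have "\<not> K \<subseteq> ?N" using NK ne by (metis subset_antisym)
      then obtain k where k: "k \<in> K" "k \<notin> ?N" by (meson subsetI)
      obtain s where s: "s \<in> carrier R" "f k = ?\<pi> s" using rep[OF K_car[OF k(1)]] by metis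
      have "s \<notin> L" using k K_car[OF k(1)] s by auto
      have "s \<in> pre K" by (rule preI[OF k(1) s])
      have "L \<subseteq> pre K"
      proof
        fix t assume t: "t \<in> L"
        then obtain y where y: "y \<in> carrier M" "f y = ?\<pi> t" using preE LD by (metis subsetD)
        then have "y \<in> K" using NK t by auto
        then show "t \<in> pre K" using preI y(2) L_car[OF t] by metis
      qed
      \<comment> \<open>The ideal of K contains L and also s, which is not in L, so maximality of L
        leaves only D.\<close>
      have "pre K = ?D"
      proof (rule ccontr)
        assume "pre K \<noteq> ?D"
        then have "pre K \<in> ?\<J>" using pre[OF K] I_pre[OF K] pre_mono[OF K] by simp
        from L_max[OF this \<open>L \<subseteq> pre K\<close>] have "pre K = L" .
        then show False using \<open>s \<in> pre K\<close> \<open>s \<notin> L\<close> by simp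
      qed
      \<comment> \<open>Now f(K) = f(M), so y differs from some k' in K by an element of the kernel
        of f. That kernel lies in \<open>?N\<close> and hence in K.\<close>
      have "y \<in> K" if y: "y \<in> carrier M" for y
      proof -
        obtain t where t: "t \<in> carrier R" "f y = ?\<pi> t" using rep[OF y] by metis
        then have "t \<in> pre K" using preI[OF y t] \<open>pre K = ?D\<close> by simp
        then obtain k' where k': "k' \<in> K" "f k' = ?\<pi> t" using preE by metis
        have "f (y \<ominus>\<^bsub>M\<^esub> k') = f y \<ominus>\<^bsub>?Q\<^esub> f k'"
          by (rule right_module_hom_minus[OF M Q f y K_car[OF k'(1)]])
        also have "\<dots> = \<zero>\<^bsub>?Q\<^esub>"
          using t(2) k'(2) Q.M.a_minus_eq_zero_iff module_hom_closed[OF f y] by simp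
        also have "\<dots> = ?\<pi> \<zero>\<^bsub>R\<^esub>"
          using right_module_hom_zero[OF reg Q \<pi>] by simp
        finally have "f (y \<ominus>\<^bsub>M\<^esub> k') \<in> ?\<pi> ` L" using submodule_zero[OF L] by simp
        then have "y \<ominus>\<^bsub>M\<^esub> k' \<in> K" using NK y K_car[OF k'(1)] by auto
        from submodule_add[OF K this k'(1)] show "y \<in> K"
          using y K_car[OF k'(1)] by (simp add: M.M.a_minus_add_cancel)
      qed
      then show ?thesis using submodule_subset[OF K] by auto
    qed
    then show "K = ?N \<or> K = carrier M" by metis
  qed (rule N)
  then have "module_Rad R M \<subseteq> ?N" and "?N \<noteq> carrier M"
    unfolding module_Rad_def maximal_submodule_def by blast+
  then show False using rad submodule_subset[OF N] by (metis subset_antisym)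
qed

text \<open>A map E \<rightarrow> R/I vanishes on E1 by the radical condition, and its restriction
  to E2 lifts by projectivity. Zero on E1 and that lift on E2 together form a lift on E.\<close>

lemma decomposition_imp_R_projective:
  fixes E :: "('a, 'm) module"
  assumes noeth: "right_noetherian R" and E: "right_module R E"
    and sum: "internal_direct_sum R E E1 E2"
    and rad: "module_Rad R (submodule_of E E1) = E1"
    and proj: "projective_module R (submodule_of E E2)"
  shows "R_projective R E"
  unfolding R_projective_def lifts_modulo_def
proof (intro conjI allI impI ballI)
  interpret E: right_module R E by (rule E)
  note reg = E.right_module_regular'
  interpret Reg: right_module R "regular_module R" by (rule reg)
  have E1: "submodule E1 R E" and E2: "submodule E2 R E" and dis: "E2 \<inter> E1 = {\<zero>\<^bsub>E\<^esub>}"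
    and car: "E1 <+>\<^bsub>E\<^esub> E2 = carrier E"
    using sum by (auto simp: internal_direct_sum_def)
  note E1_car = subsetD[OF submodule_subset[OF E1]]
  note E2_car = subsetD[OF submodule_subset[OF E2]]
  fix I f assume I: "right_ideal R I"
    and f: "f \<in> module_hom R E (quotient_module (regular_module R) I)"
  let ?Q = "quotient_module (regular_module R) I"
  have I': "submodule I R (regular_module R)" using I by (simp add: right_ideal_def)
  have Q: "right_module R ?Q" by (rule Reg.right_module_quotient[OF I'])
  interpret Q: right_module R ?Q by (rule Q)
  have f1: "f x = \<zero>\<^bsub>?Q\<^esub>" if "x \<in> E1" for x
    using radical_hom_cyclic_zero[OF noeth E.right_module_submodule[OF E1] _ I
        module_hom_restrict[OF f submodule_subset[OF E1]]] rad that by simp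
  \<comment> \<open>R enters the test type through constant functions, and R/I through their images
    on cosets.\<close>
  obtain l where l: "l \<in> module_hom R (submodule_of E E2) (regular_module R)"
    and fl: "\<And>x. x \<in> carrier (submodule_of E E2) \<Longrightarrow> I +>\<^bsub>regular_module R\<^esub> l x = f x"
    by (rule projective_module_lifting[OF proj reg inj_const_singleton Q inj_image_const
          Reg.module_hom_coset[OF I'] module_hom_restrict[OF f submodule_subset[OF E2]]],
        rule that)
  have zero: "(\<lambda>_. \<zero>\<^bsub>R\<^esub>) \<in> module_hom R (submodule_of E E1) (regular_module R)"
    by (rule module_homI) auto
  obtain h where h: "h \<in> module_hom R (submodule_of E (E1 <+>\<^bsub>E\<^esub> E2)) (regular_module R)"
    and h_add: "\<And>a b. a \<in> E1 \<Longrightarrow> b \<in> E2 \<Longrightarrow>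
      h (a \<oplus>\<^bsub>E\<^esub> b) = \<zero>\<^bsub>R\<^esub> \<oplus>\<^bsub>regular_module R\<^esub> l b"
    by (rule E.disjoint_sum_hom[OF E1 E2 dis reg zero l], rule that)
  have "h \<in> module_hom R E (regular_module R)"
    using h unfolding car by (simp add: module_hom_def)
  moreover have "f x = I +>\<^bsub>R\<^esub> h x" if "x \<in> carrier E" for x
  proof -
    have "x \<in> E1 <+>\<^bsub>E\<^esub> E2" using that car by simp
    then obtain a b where ab: "a \<in> E1" "b \<in> E2" and x: "x = a \<oplus>\<^bsub>E\<^esub> b" by (rule E.set_addE)
    have "f x = f b"
      using module_hom_add[OF f E1_car E2_car] ab f1 module_hom_closed[OF f E2_car] x by simp
    also have "\<dots> = I +>\<^bsub>regular_module R\<^esub> l b" using fl ab(2) by simp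
    also have "l b = h x"
      using h_add[OF ab] module_hom_closed[OF l, of b] ab(2) x by simp
    finally show ?thesis by (simp add: regular_coset)
  qed
  ultimately show "\<exists>h\<in>module_hom R E (regular_module R). \<forall>x\<in>carrier E. f x = I +>\<^bsub>R\<^esub> h x"
    by blast
qed (rule E)

text \<open>E1 is the reject of R in E and E2 the kernel of the retraction onto it. The hypothesis
  on R makes E1 radical, while E2 is a torsionless Baer module and therefore projective.\<close>

lemma right_max_QF_imp_decomposition:
  fixes E :: "('a, 'm) module"
  assumes noeth: "right_noetherian R" and ns: "right_nonsingular R"
    and QF: "right_max_QF TYPE('m) R" and inj: "injective_module R E"
  obtains E1 E2 where "internal_direct_sum R E E1 E2"
    "module_Rad R (submodule_of E E1) = E1" "projective_module R (submodule_of E E2)"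
proof -
  have E: "right_module R E" using inj by (simp add: injective_module_def)
  interpret E: right_module R E by (rule E)
  note reg = E.right_module_regular'
  have baer: "baer R E" by (rule injective_module_imp_baer[OF inj])
  define E1 where "E1 = {e \<in> carrier E. \<forall>h\<in>module_hom R E (regular_module R). h e = \<zero>\<^bsub>R\<^esub>}"
  obtain g where E1: "submodule E1 R E" and g: "g \<in> module_hom R E E"
    and gE1: "g ` carrier E \<subseteq> E1" and g_id: "\<And>k. k \<in> E1 \<Longrightarrow> g k = k"
    by (rule E.reject_retraction[OF ns baer, folded E1_def], rule that)
  note E1_car = subsetD[OF submodule_subset[OF E1]]
  have E1_hom: "h e = \<zero>\<^bsub>R\<^esub>" if "h \<in> module_hom R E (regular_module R)" "e \<in> E1" for h e
    using that by (simp add: E1_def)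
  define E2 where "E2 = {e \<in> carrier E. g e \<in> {\<zero>\<^bsub>E\<^esub>}}"
  have E2: "submodule E2 R E"
    unfolding E2_def by (rule submodule_vimage[OF E E g E.submodule_singleton_zero])
  note E2_car = subsetD[OF submodule_subset[OF E2]]
  \<comment> \<open>The complementary projection 1 - g of E onto E2.\<close>
  define q where "q e = e \<ominus>\<^bsub>E\<^esub> g e" for e
  have q: "q \<in> module_hom R E E"
    unfolding q_def by (rule module_hom_diff[OF E module_hom_id g])
  have g_closed: "g e \<in> E1" if "e \<in> carrier E" for e using gE1 that by blast
  have q_E2: "q e \<in> E2" if e: "e \<in> carrier E" for e
  proof -
    note ge = E1_car[OF g_closed[OF e]]
    have "g (q e) = g e \<ominus>\<^bsub>E\<^esub> g (g e)"
      unfolding q_def by (rule right_module_hom_minus[OF E E g e ge])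
    also have "\<dots> = \<zero>\<^bsub>E\<^esub>" using g_id[OF g_closed[OF e]] ge by (simp add: E.M.a_minus_eq_zero_iff)
    finally show ?thesis using module_hom_closed[OF q e] by (simp add: E2_def)
  qed
  have q_id: "q e = e" if e: "e \<in> E2" for e
    using e E.M.a_add_minus_cancel[OF E2_car[OF e] E.M.zero_closed]
    by (simp add: E2_def q_def)
  have dis: "E1 \<inter> E2 = {\<zero>\<^bsub>E\<^esub>}"
  proof
    show "E1 \<inter> E2 \<subseteq> {\<zero>\<^bsub>E\<^esub>}" using g_id by (force simp: E2_def)
    show "{\<zero>\<^bsub>E\<^esub>} \<subseteq> E1 \<inter> E2" using submodule_zero[OF E1] submodule_zero[OF E2] by simp
  qed
  have "e \<in> E1 <+>\<^bsub>E\<^esub> E2" if e: "e \<in> carrier E" for e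
  proof -
    have "e = g e \<oplus>\<^bsub>E\<^esub> q e"
      using E.M.a_minus_add_cancel[OF e E1_car[OF g_closed[OF e]]] module_hom_closed[OF q e]
        E1_car[OF g_closed[OF e]] by (simp add: q_def E.M.a_comm)
    then show ?thesis using E.set_addI[OF g_closed[OF e] q_E2[OF e]] by simp
  qed
  then have "E1 <+>\<^bsub>E\<^esub> E2 = carrier E"
    using submodule_subset[OF E.submodule_set_add[OF E1 E2]] by blast
  then have "internal_direct_sum R E E1 E2"
    using E1 E2 dis by (simp add: internal_direct_sum_def)
  moreover have "module_Rad R (submodule_of E E1) = E1"
  proof (rule ccontr)
    assume "module_Rad R (submodule_of E E1) \<noteq> E1"
    then obtain N where N: "maximal_submodule R (submodule_of E E1) N"
      by (auto simp: module_Rad_def)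
    note modE1 = E.right_module_submodule[OF E1]
    have "injective_module R (submodule_of E E1)"
      by (rule baer_imp_injective_module[OF modE1 baer_retract[OF E baer E1 g gE1 g_id]])
    then have max: "max_projective R (submodule_of E E1)"
      using QF by (simp add: right_max_QF_def)
    obtain h x where h: "h \<in> module_hom R (submodule_of E E1) (regular_module R)"
      and x: "x \<in> carrier (submodule_of E E1)" and hx: "h x \<noteq> \<zero>\<^bsub>R\<^esub>"
      by (rule max_projective_imp_hom[OF modE1 max N], rule that)
    \<comment> \<open>Extending h through g gives a map E \<rightarrow> R that does not vanish at x
      in E1, against the definition of E1.\<close>
    have "(\<lambda>e. h (g e)) \<in> module_hom R E (regular_module R)"
      by (rule module_hom_comp[OF module_hom_into[OF g gE1] h])
    then have "h (g x) = \<zero>\<^bsub>R\<^esub>" using E1_hom x by simp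
    then show False using hx g_id x by simp
  qed
  moreover have "projective_module R (submodule_of E E2)"
    unfolding projective_module_def
  proof (intro conjI allI impI)
    show modE2: "right_module R (submodule_of E E2)" by (rule E.right_module_submodule[OF E2])
    interpret E2: right_module R "submodule_of E E2" by (rule modE2)
    have "q ` carrier E \<subseteq> E2" using q_E2 by blast
    then have baer2: "baer R (submodule_of E E2)" by (rule baer_retract[OF E baer E2 q _ q_id])
    \<comment> \<open>A nonzero m in E2 is not in E1, so some map E \<rightarrow> R does not kill
      it. Its restriction to E2 separates m from zero.\<close>
    have torsionless: "\<exists>h\<in>module_hom R (submodule_of E E2) (regular_module R). h m \<noteq> \<zero>\<^bsub>R\<^esub>"
      if "m \<in> carrier (submodule_of E E2)" "m \<noteq> \<zero>\<^bsub>submodule_of E E2\<^esub>" for m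
    proof -
      have "m \<notin> E1" and "m \<in> carrier E" using that dis E2_car by auto
      then obtain h where "h \<in> module_hom R E (regular_module R)" "h m \<noteq> \<zero>\<^bsub>R\<^esub>"
        by (auto simp: E1_def)
      then show ?thesis using module_hom_restrict[OF _ submodule_subset[OF E2]] by metis
    qed
    fix B C :: "('a, ('m \<Rightarrow> 'a) set) module" and v f
    assume "right_module R B \<and> right_module R C \<and> v \<in> module_hom R B C \<and>
      v ` carrier B = carrier C \<and> f \<in> module_hom R (submodule_of E E2) C"
    then have B: "right_module R B" and C: "right_module R C" and v: "v \<in> module_hom R B C"
      "v ` carrier B = carrier C" and f: "f \<in> module_hom R (submodule_of E E2) C" by simp_all
    obtain l where "l \<in> module_hom R (submodule_of E E2) B"
      "\<And>x. x \<in> carrier (submodule_of E E2) \<Longrightarrow> v (l x) = f x"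
      by (rule E2.torsionless_lifting[OF noeth ns baer2 torsionless B C v f], assumption+, rule that)
    then show "\<exists>h\<in>module_hom R (submodule_of E E2) B.
        \<forall>x\<in>carrier (submodule_of E E2). v (h x) = f x" by blast
  qed
  ultimately show thesis by (rule that)
qed

theorem proposition1:
  fixes R :: "('a, 'r) ring_scheme" (structure)
  assumes "ring R"
    and "right_noetherian R"
    and "right_nonsingular R"
  shows "(right_almost_QF TYPE('m) R \<longleftrightarrow> right_max_QF TYPE('m) R) \<and>
    (right_max_QF TYPE('m) R \<longleftrightarrow>
      (\<forall>E :: ('a, 'm) module. injective_module R E \<longrightarrow>
        (\<exists>E1 E2. internal_direct_sum R E E1 E2 \<and>
          module_Rad R (submodule_of E E1) = E1 \<and>
          projective_module R (submodule_of E E2))))"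
proof -
  let ?dec = "\<forall>E :: ('a, 'm) module. injective_module R E \<longrightarrow>
        (\<exists>E1 E2. internal_direct_sum R E E1 E2 \<and>
          module_Rad R (submodule_of E E1) = E1 \<and>
          projective_module R (submodule_of E E2))"
  \<comment> \<open>The equivalences follow from a cycle of three implications. This first one holds
    because maximal right ideals are right ideals.\<close>
  have "right_almost_QF TYPE('m) R \<Longrightarrow> right_max_QF TYPE('m) R"
    by (simp add: right_almost_QF_def right_max_QF_def R_projective_def max_projective_def
        right_ideal_def maximal_right_ideal_def maximal_submodule_def)
  moreover have "right_max_QF TYPE('m) R \<Longrightarrow> ?dec"
    using right_max_QF_imp_decomposition[OF assms(2,3)] by metis
  moreover have "?dec \<Longrightarrow> right_almost_QF TYPE('m) R"
    unfolding right_almost_QF_def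
    using decomposition_imp_R_projective[OF assms(2)] by (metis injective_module_def)
  ultimately show ?thesis by blast
qed

end
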